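(* Assume the setting described in the context (the algorithm, the standing assumptions, $2f$-redundancy), and assume the following Polyak–Łojasiewicz-type condition, with $x^{\star}_{\mathcal{H}}$ a minimizer of $q_{\mathcal{H}}$: there is $\mu>0$ such that for all $k\ge0$ $$\tfrac12\|\nabla q_{\mathcal{H}}(\bar{x}_k)\|^{2}\ge\mu\big(q_{\mathcal{H}}(\bar{x}_k)-q_{\mathcal{H}}(x^{\star}_{\mathcal{H}})\big)\ge\tfrac{\mu^{2}}{2}\|\bar{x}_k-x^{\star}_{\mathcal{H}}\|^{2}.$$ Let $V_k=\big(q_{\mathcal{H}}(\bar{x}_k)-q_{\mathcal{H}}(x^{\star}_{\mathcal{H}})\big)+W_k$. (i) Suppose that the step sizes satisfy, for all $k\ge0$, $$\alpha_k\le\frac{\mu^{2}}{6^{4}(L+1)^{3}\mathcal{T}},\qquad \beta_k\le\frac{\mu^{2}}{12^{4}L^{3}\mathcal{T}},\qquad \frac{\beta_k}{\alpha_k}\le\frac{\mu^{2}}{12^{4}(L+1)^{4}\mathcal{T}^{2}}.$$ Then for all $k\ge0$ $$\mathbb{E}[V_{k+1}]\le\Big(1-\frac{9\mu\mathcal{T}\beta_k}{6}+\frac{4L\mathcal{T}\beta_k|\mathcal{B}_k|}{|\mathcal{H}|}\Big)\mathbb{E}[V_k]+150(L+1)^{2}\mathcal{T}^{2}\sigma^{2}\alpha_k^{2}+\frac{112(L+1)^{2}\mathcal{T}^{2}\sigma^{2}f\alpha_k^{2}}{|\mathcal{H}|}.$$ (ii) If in addition $$\frac{|\mathcal{B}_{k}|}{|\mathcal{H}|}=\frac{f}{N-f}\le\frac{\mu}{3L},$$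 and the constants $C_\alpha,C_\beta,h$ in the step sizes satisfy $$C_\alpha\ge\frac{12^{5}(L+1)^{4}\mathcal{T}}{\mu^{3}},\qquad C_\beta=\frac{12}{\mu\mathcal{T}},\qquad h\ge\max\Big\{\frac{6^{4}(L+1)^{3}\mathcal{T}C_\alpha}{\mu^{2}},\ \frac{12^{5}L^{3}}{\mu^{3}}\Big\},$$ then for all $k\ge0$ $$\mathbb{E}[V_{k+1}]\le\frac{h^{2}\,\mathbb{E}[V_0]}{(1+h+k)^{2}}+\frac{150\mathcal{T}\sigma^{2}C_\alpha^{2}}{1+h+k}+\frac{112\mathcal{T}^{2}\sigma^{2}fC_\alpha^{2}}{(1+h+k)|\mathcal{H}|}.$$
   Context: Setting. There are $N$ agents and a server; $\mathcal{H}$ is the set of honest agents, $|\mathcal{H}|=N-f$, and the other $f$ agents are Byzantine (identities unknown to the server). Each honest agent $i$ has a differentiable function $q^{i}:\mathbb{R}^{d}\to\mathbb{R}$; $q_{\mathcal{H}}(x)=\frac{1}{|\mathcal{H}|}\sum_{i\in\mathcal{H}}q^{i}(x)$. $2f$-redundancy: for every $\mathcal{S}\subset\mathcal{H}$ with $|\mathcal{S}|\ge N-2f$, $\arg\min_x\sum_{i\in\mathcal{S}}q^{i}(x)=\arg\min_x\sum_{i\in\mathcal{H}}q^{i}(x)$. The following consequence (known from prior work) is a standing fact: $\bigcap_{i\in\mathcal{H}}\mathcal{X}_i^{\star}=\mathcal{X}_{\mathcal{H}}^{\star}$, where $\mathcal{X}_i^{\star},\mathcal{X}_{\mathcal{H}}^{\star}$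 are the sets of minimizers of $q^{i},q_{\mathcal{H}}$; in particular $\nabla q^{i}(x_{\mathcal{H}}^{\star})=0$ for all $i\in\mathcal{H}$. Algorithm. Given $\bar{x}_0\in\mathbb{R}^d$, $y^{i}_{0,0}\in\mathbb{R}^d$, an integer $\mathcal{T}\ge 1$ and step sizes $\alpha_k,\beta_k$. At round $k=0,1,2,\dots$: each honest agent $i$ sets $x^{i}_{k,0}=\bar{x}_k$ and (for $k\ge1$) $y^{i}_{k,0}=y^{i}_{k-1,\mathcal{T}}$, and for $t=0,\dots,\mathcal{T}-1$ computes $x^{i}_{k,t+1}=x^{i}_{k,t}-\beta_k y^{i}_{k,t}$, $\;y^{i}_{k,t+1}=(1-\alpha_k)y^{i}_{k,t}+\alpha_k\nabla q^{i}(x^{i}_{k,t};\Delta^{i}_{k,t})$, where $\nabla q^{i}(\cdot;\Delta^{i}_{k,t})$ is a stochastic sample of $\nabla q^{i}(\cdot)$. Each honest agent sends $x^{i}_{k,\mathcal{T}}$ to the server; a Byzantine agent $i$ observes the entire network and sends an arbitrary vector, also denoted $x^{i}_{k,\mathcal{T}}$. The server sorts the distances $\|\bar{x}_k-x^{i}_{k,\mathcal{T}}\|$ in ascending order, discards the $f$ agents with the largest distances, lets $\mathcal{F}_k$ be the set of the remaining $N-f$ agents, and sets $\bar{x}_{k+1}=\frac{1}{|\mathcal{F}_k|}\sum_{i\in\mathcal{F}_k}x^{i}_{k,\mathcal{T}}$. $\mathcal{B}_k$ is the set of Byzantine agents in $\mathcal{F}_k$ and $\mathcal{H}_k$ the set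 of honest agents in $\mathcal{F}_k$; so $|\mathcal{B}_k|=|\mathcal{H}\setminus\mathcal{H}_k|\le f$. Step sizes: $\alpha_k=\frac{C_\alpha}{1+h+k}$, $\beta_k=\frac{C_\beta}{1+h+k}$ with $h>1$, $0<C_\beta\le C_\alpha$, $\alpha_k\le1$ and $L\mathcal{T}\beta_k\le1$ for all $k\ge0$. Standing assumptions. (Noise) The samples $\Delta^{i}_{k,t}$ are i.i.d.; with $\mathcal{P}_{k,t}$ the $\sigma$-algebra of all random variables generated by the algorithm up to (not including) the sampling of $\Delta_{k,t}^i$ at local step $t$ of round $k$ (so $\bar{x}_k,x^{i}_{k,t},y^{i}_{k,t}$ are $\mathcal{P}_{k,t}$-measurable), for every $x$ (including $\mathcal{P}_{k,t}$-measurable $x$): $\mathbb{E}[\nabla q^{i}(x;\Delta^{i}_{k,t})\mid\mathcal{P}_{k,t}]=\nabla q^{i}(x)$ and $\mathbb{E}[\|\nabla q^{i}(x;\Delta^{i}_{k,t})-\nabla q^{i}(x)\|^{2}\mid\mathcal{P}_{k,t}]\le\sigma^{2}$. (Smoothness) For each $i\in\mathcal{H}$, $\|\nabla q^{i}(y)-\nabla q^{i}(x)\|\le L\|y-x\|$ for all $x,y$, with $L>0$. Notation: $e^{i}_{k,t}=y^{i}_{k,t}-\nabla q^{i}(\bar{x}_k)$ and $W_k=\frac{1}{|\mathcal{H}|}\sum_{i\in\mathcal{H}}\|e^{i}_{k,0}\|^{2}$.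
   Formalization: Adds μ ≤ L, which PL and L-smoothness imply unless x̄_k = x* almost surely for every k, where the PL condition holds for any μ and the claim can fail; in (i), as |B_k| may be random, its factor is placed inside the expectation with V_k. *)

theory Defs
  imports "HOL-Probability.Probability"
begin

definition grad :: "('v::real_inner \<Rightarrow> real) \<Rightarrow> 'v \<Rightarrow> 'v" where
  "grad f x = (THE D. GDERIV f x :> D)"

lemma GDERIV_imp_grad:
  fixes f :: "'v::real_inner \<Rightarrow> real"
  assumes "GDERIV f x :> D"
  shows "grad f x = D"
  unfolding grad_def
proof (rule the_equality)
  fix D' assume "GDERIV f x :> D'"
  then have "(\<lambda>h. inner h D') = (\<lambda>h. inner h D)"
    using assms has_derivative_unique unfolding gderiv_def by blast
  then have "inner h D' = inner h D" for h by metis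
  then show "D' = D"
    by (metis inner_commute vector_eq_ldot)
qed (fact assms)

lemma differentiable_imp_GDERIV_grad:
  fixes f :: "'v::euclidean_space \<Rightarrow> real"
  assumes "f differentiable (at x)"
  shows "GDERIV f x :> grad f x"
proof -
  obtain f' where f': "(f has_derivative f') (at x)"
    using assms unfolding differentiable_def by blast
  interpret bounded_linear f' using f' by (rule has_derivative_bounded_linear)
  have "f' = (\<lambda>h. inner h (\<Sum>b\<in>Basis. f' b *\<^sub>R b))"
  proof
    fix h
    have "f' h = f' (\<Sum>b\<in>Basis. inner h b *\<^sub>R b)" by (simp add: euclidean_representation)
    also have "\<dots> = (\<Sum>b\<in>Basis. inner h b * f' b)" by (simp add: sum scaleR)
    finally show "f' h = inner h (\<Sum>b\<in>Basis. f' b *\<^sub>R b)"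
      by (simp add: inner_sum_right mult.commute)
  qed
  then have "GDERIV f x :> (\<Sum>b\<in>Basis. f' b *\<^sub>R b)"
    using f' unfolding gderiv_def by metis
  then show ?thesis using GDERIV_imp_grad by metis
qed

definition minimizers :: "('v \<Rightarrow> real) \<Rightarrow> 'v set" where
  "minimizers f = {x. is_arg_min f (\<lambda>_. True) x}"

definition avg_obj :: "nat set \<Rightarrow> (nat \<Rightarrow> 'v \<Rightarrow> real) \<Rightarrow> 'v \<Rightarrow> real" where
  "avg_obj H q x = (1 / real (card H)) * (\<Sum>i\<in>H. q i x)"

text \<open>The bound on the cardinality is stated over the integers, since \<open>N - 2 * f\<close> may be negative.\<close>

definition redundancy :: "nat \<Rightarrow> nat \<Rightarrow> nat set \<Rightarrow> (nat \<Rightarrow> 'v \<Rightarrow> real) \<Rightarrow> bool" where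
  "redundancy N f H q \<longleftrightarrow>
    (\<forall>S\<subseteq>H. int (card S) \<ge> int N - 2 * int f \<longrightarrow>
      minimizers (\<lambda>x. \<Sum>i\<in>S. q i x) = minimizers (\<lambda>x. \<Sum>i\<in>H. q i x))"

text \<open>
  The agents are \<open>{..<N}\<close>, the honest ones \<open>H\<close>. \<open>comparative_elimination N f d F\<close> says that \<open>F\<close>
  consists of the first \<open>N - f\<close> agents in some ascending ordering by \<open>d\<close>; ties may be broken
  in any way.
\<close>

definition comparative_elimination :: "nat \<Rightarrow> nat \<Rightarrow> (nat \<Rightarrow> real) \<Rightarrow> nat set \<Rightarrow> bool" where
  "comparative_elimination N f d F \<longleftrightarrow>
    (\<exists>js. distinct js \<and> set js = {..<N} \<and> sorted (map d js) \<and> F = set (take (N - f) js))"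

text \<open>
  One sample path of the algorithm, with index order agent, round, local step. The values
  \<open>x i k T\<close> of the agents \<open>i \<notin> H\<close> (their messages) are not constrained; the other values
  of \<open>x\<close> and \<open>y\<close> at \<open>i \<notin> H\<close> play no role.
\<close>

definition algorithm_path ::
  "nat \<Rightarrow> nat \<Rightarrow> nat set \<Rightarrow> nat \<Rightarrow> (nat \<Rightarrow> real) \<Rightarrow> (nat \<Rightarrow> real) \<Rightarrow> (nat \<Rightarrow> 'v \<Rightarrow> 's \<Rightarrow> 'v)
    \<Rightarrow> 'v::real_normed_vector \<Rightarrow> (nat \<Rightarrow> 'v) \<Rightarrow> (nat \<Rightarrow> nat \<Rightarrow> nat \<Rightarrow> 's)
    \<Rightarrow> (nat \<Rightarrow> 'v) \<Rightarrow> (nat \<Rightarrow> nat \<Rightarrow> nat \<Rightarrow> 'v) \<Rightarrow> (nat \<Rightarrow> nat \<Rightarrow> nat \<Rightarrow> 'v)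
    \<Rightarrow> (nat \<Rightarrow> nat set) \<Rightarrow> bool" where
  "algorithm_path N f H T \<alpha> \<beta> g x0 y0 \<Delta> xbar x y F \<longleftrightarrow>
    xbar 0 = x0 \<and>
    (\<forall>i\<in>H. y i 0 0 = y0 i) \<and>
    (\<forall>k. \<forall>i\<in>H. x i k 0 = xbar k \<and> y i (Suc k) 0 = y i k T) \<and>
    (\<forall>k. \<forall>i\<in>H. \<forall>t<T.
       x i k (Suc t) = x i k t - \<beta> k *\<^sub>R y i k t \<and>
       y i k (Suc t) = (1 - \<alpha> k) *\<^sub>R y i k t + \<alpha> k *\<^sub>R g i (x i k t) (\<Delta> i k t)) \<and>
    (\<forall>k. comparative_elimination N f (\<lambda>i. norm (xbar k - x i k T)) (F k)) \<and>
    (\<forall>k. xbar (Suc k) = (1 / real (card (F k))) *\<^sub>R (\<Sum>i\<in>F k. x i k T))"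

text \<open>
  The sigma-algebra of everything generated before the samples of local step \<open>t\<close> of round \<open>k\<close>
  are drawn, including the Byzantine messages and the server's selections of earlier rounds.
\<close>

definition history ::
  "'w measure \<Rightarrow> 's measure \<Rightarrow> nat \<Rightarrow> nat set \<Rightarrow> nat \<Rightarrow> (nat \<Rightarrow> nat \<Rightarrow> nat \<Rightarrow> 'w \<Rightarrow> 's)
    \<Rightarrow> (nat \<Rightarrow> 'w \<Rightarrow> 'v::topological_space) \<Rightarrow> (nat \<Rightarrow> nat \<Rightarrow> nat \<Rightarrow> 'w \<Rightarrow> 'v) \<Rightarrow> (nat \<Rightarrow> nat \<Rightarrow> nat \<Rightarrow> 'w \<Rightarrow> 'v)
    \<Rightarrow> (nat \<Rightarrow> 'w \<Rightarrow> nat set) \<Rightarrow> nat \<Rightarrow> nat \<Rightarrow> 'w measure" where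
  "history M D N H T \<Delta> xbar x y F k t = sigma (space M)
    ({xbar l -` A \<inter> space M | l A. l \<le> k \<and> A \<in> sets borel} \<union>
     {x i l s -` A \<inter> space M | i l s A.
        i \<in> H \<and> (l < k \<and> s \<le> T \<or> l = k \<and> s \<le> t) \<and> A \<in> sets borel} \<union>
     {y i l s -` A \<inter> space M | i l s A.
        i \<in> H \<and> (l < k \<and> s \<le> T \<or> l = k \<and> s \<le> t) \<and> A \<in> sets borel} \<union>
     {\<Delta> i l s -` A \<inter> space M | i l s A.
        i \<in> H \<and> (l < k \<and> s < T \<or> l = k \<and> s < t) \<and> A \<in> sets D} \<union>
     {x i l T -` A \<inter> space M | i l A. i \<in> {..<N} - H \<and> l < k \<and> A \<in> sets borel} \<union>
     {F l -` A \<inter> space M | l A. l < k})"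

definition vec_cond_exp ::
  "'w measure \<Rightarrow> 'w measure \<Rightarrow> ('w \<Rightarrow> 'v::euclidean_space) \<Rightarrow> 'w \<Rightarrow> 'v" where
  "vec_cond_exp M P Z \<omega> = (\<Sum>b\<in>Basis. real_cond_exp M P (\<lambda>w. inner (Z w) b) \<omega> *\<^sub>R b)"

text \<open>
  The second moment uses the \<open>ennreal\<close>-valued conditional expectation because the real-valued
  one is 0 where the conditional expectation is infinite.
\<close>

definition gradient_oracle ::
  "'w measure \<Rightarrow> 'w measure \<Rightarrow> ('v::euclidean_space \<Rightarrow> 's \<Rightarrow> 'v) \<Rightarrow> ('v \<Rightarrow> 'v) \<Rightarrow> ('w \<Rightarrow> 's) \<Rightarrow> real \<Rightarrow> bool" where
  "gradient_oracle M P g dq \<Delta> \<sigma> \<longleftrightarrow>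
    (\<forall>X \<in> borel_measurable P.
      (AE \<omega> in M. vec_cond_exp M P (\<lambda>w. g (X w) (\<Delta> w)) \<omega> = dq (X \<omega>)) \<and>
      (AE \<omega> in M. nn_cond_exp M P (\<lambda>w. ennreal ((norm (g (X w) (\<Delta> w) - dq (X w)))\<^sup>2)) \<omega>
         \<le> ennreal (\<sigma>\<^sup>2)))"

text \<open>Tracking error \<open>e\<close>, its mean square \<open>W\<close> at the start of a round, and the Lyapunov function \<open>V\<close>.\<close>

definition track_err ::
  "(nat \<Rightarrow> 'v \<Rightarrow> real) \<Rightarrow> (nat \<Rightarrow> 'w \<Rightarrow> 'v) \<Rightarrow> (nat \<Rightarrow> nat \<Rightarrow> nat \<Rightarrow> 'w \<Rightarrow> 'v::real_inner)
    \<Rightarrow> nat \<Rightarrow> nat \<Rightarrow> nat \<Rightarrow> 'w \<Rightarrow> 'v" where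
  "track_err q xbar y i k t \<omega> = y i k t \<omega> - grad (q i) (xbar k \<omega>)"

definition W_fun ::
  "nat set \<Rightarrow> (nat \<Rightarrow> 'v \<Rightarrow> real) \<Rightarrow> (nat \<Rightarrow> 'w \<Rightarrow> 'v)
    \<Rightarrow> (nat \<Rightarrow> nat \<Rightarrow> nat \<Rightarrow> 'w \<Rightarrow> 'v::real_inner) \<Rightarrow> nat \<Rightarrow> 'w \<Rightarrow> real" where
  "W_fun H q xbar y k \<omega> =
    (1 / real (card H)) * (\<Sum>i\<in>H. (norm (track_err q xbar y i k 0 \<omega>))\<^sup>2)"

definition V_fun ::
  "nat set \<Rightarrow> (nat \<Rightarrow> 'v \<Rightarrow> real) \<Rightarrow> 'v \<Rightarrow> (nat \<Rightarrow> 'w \<Rightarrow> 'v)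
    \<Rightarrow> (nat \<Rightarrow> nat \<Rightarrow> nat \<Rightarrow> 'w \<Rightarrow> 'v::real_inner) \<Rightarrow> nat \<Rightarrow> 'w \<Rightarrow> real" where
  "V_fun H q xs xbar y k \<omega> =
    (avg_obj H q (xbar k \<omega>) - avg_obj H q xs) + W_fun H q xbar y k \<omega>"

end

(*
  Every round is compared pathwise with exact averaging over the honest agents. Each Byzantine
  vector that survives elimination is no longer than every honest vector that was discarded, so
  with rho = |B_k| / |H|, v_i the gradient of q^i and G their average, the first-order change of
  q_H per unit of step size T beta_k is at most -|G|^2 + 2 |G| (sum of |v_j| over discarded
  honest j) / |H|. Under 2 f-redundancy v_i vanishes at the common minimizer xs, and this is at most
  (4 L rho - 2 mu) (q_H - min q_H): for L rho <= mu by |v_j| <= L |x - xs| and the PL condition,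
  for L rho > mu by Cauchy-Schwarz and |v_j|^2 <= 2 L (q^j - min q^j).

  The tracking error contracts by 1 - alpha_k per local step and, the noise being orthogonal to
  the past, gains only alpha_k^2 sigma^2 plus a drift term of order beta_k^2. Since beta_k / alpha_k
  is small, all cross terms are absorbed and the noise term is 150 T sigma^2 alpha_k^2, without the
  factor (L + 1)^2 T of part (i). Part (ii) needs this sharper recursion; it follows by
  multiplying with (1 + h + k)^2.
*)
theory Submission
  imports Defs
begin

subsection \<open>Smooth objectives and elimination\<close>

text \<open>The adversary sees the whole network, so the surviving set \<open>F k\<close> and the
  messages in it may depend on every sample of the round, and no conditional expectation is
  available for the server step. Hence everything that involves elimination is an inequality on a
  single sample path; the zero mean of the noise is used only in the local recursion of
  \<open>y\<close>.

  Part (i) does not bound rho by mu / L, which is why the regime L rho > mu has to be covered. As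
  |B_k| is random, its factor stays under the integral next to \<open>V k\<close>. The drift bound
  of a round contains the tracking errors of the same round, so the estimate closes only after this
  circular term is absorbed; the small ratio \<open>\<beta> k / \<alpha> k\<close> serves this
  purpose and also cancels powers of T and a factor 1 / mu. The summands with f in the two
  conclusions are nonnegative and enter last, since the pathwise comparison charges the adversary to
  the contraction factor and not to the noise.\<close>

lemma descent_lemma:
  fixes f :: "'v::euclidean_space \<Rightarrow> real"
  assumes diff: "\<And>z. f differentiable (at z)"
    and lip: "\<And>z w. norm (grad f w - grad f z) \<le> L * norm (w - z)"
  shows "f w \<le> f z + inner (grad f z) (w - z) + L / 2 * (norm (w - z))\<^sup>2"
proof -
  define d where "d = w - z"
  \<comment> \<open>The quadratic term integrates the Lipschitz bound on the slope. Subtracting it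
    makes \<open>\<phi>\<close> nonincreasing on the unit interval, so comparing
    \<open>\<phi> 1\<close> with \<open>\<phi> 0\<close> replaces integration of the gradient along
    the segment.\<close>
  define \<phi> where "\<phi> s = f (z + s *\<^sub>R d) - s * inner (grad f z) d - L / 2 * s\<^sup>2 * (norm d)\<^sup>2" for s
  define \<phi>' where "\<phi>' s = inner d (grad f (z + s *\<^sub>R d)) - inner (grad f z) d - L * s * (norm d)\<^sup>2" for s
  have der: "(\<phi> has_real_derivative \<phi>' s) (at s)" for s
  proof -
    have "(f has_derivative (\<lambda>h. inner h (grad f (z + s *\<^sub>R d)))) (at (z + s *\<^sub>R d))"
      using differentiable_imp_GDERIV_grad[OF diff] by (simp add: gderiv_def)
    moreover have "((\<lambda>s. z + s *\<^sub>R d) has_derivative (\<lambda>h. h *\<^sub>R d)) (at s)"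
      by (auto intro!: derivative_eq_intros)
    ultimately have "((\<lambda>s. f (z + s *\<^sub>R d)) has_derivative
        (\<lambda>h. inner (h *\<^sub>R d) (grad f (z + s *\<^sub>R d)))) (at s)"
      by (rule has_derivative_compose[rotated])
    then have "((\<lambda>s. f (z + s *\<^sub>R d)) has_real_derivative inner d (grad f (z + s *\<^sub>R d))) (at s)"
      by (simp add: has_field_derivative_def mult_commute_abs)
    then show ?thesis unfolding \<phi>_def \<phi>'_def
      by (auto intro!: derivative_eq_intros)
  qed
  have "\<phi> 1 \<le> \<phi> 0"
  proof (rule DERIV_nonpos_imp_nonincreasing[of 0 1 \<phi>])
    fix s :: real assume s: "0 \<le> s" "s \<le> 1"
    have "inner d (grad f (z + s *\<^sub>R d)) - inner (grad f z) d
        = inner d (grad f (z + s *\<^sub>R d) - grad f z)"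
      by (simp add: inner_diff_right inner_commute)
    also have "\<dots> \<le> norm d * norm (grad f (z + s *\<^sub>R d) - grad f z)"
      by (rule norm_cauchy_schwarz)
    also have "\<dots> \<le> norm d * (L * norm (s *\<^sub>R d))"
      using lip[of "z + s *\<^sub>R d" z] by (intro mult_left_mono) auto
    also have "\<dots> = L * s * (norm d)\<^sup>2" using s by (simp add: power2_eq_square)
    finally have "\<phi>' s \<le> 0" by (simp add: \<phi>'_def)
    then show "\<exists>y. (\<phi> has_real_derivative y) (at s) \<and> y \<le> 0" using der by blast
  qed simp
  then show ?thesis by (simp add: \<phi>_def d_def algebra_simps)
qed

lemma minimizers_le: "xs \<in> minimizers f \<Longrightarrow> f xs \<le> f z"
  by (simp add: minimizers_def is_arg_min_linorder)

text \<open>A gradient step of length 1 / L lowers \<open>f\<close> by at least the squared gradient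
  norm over 2 L, and no step can go below the minimum. At \<open>z = xs\<close> the same inequality
  forces the gradient to vanish.\<close>

lemma grad_norm_sq_le:
  fixes f :: "'v::euclidean_space \<Rightarrow> real"
  assumes "\<And>z. f differentiable (at z)"
    and "\<And>z w. norm (grad f w - grad f z) \<le> L * norm (w - z)"
    and "xs \<in> minimizers f" and "L > 0"
  shows "(norm (grad f z))\<^sup>2 \<le> 2 * L * (f z - f xs)"
proof -
  let ?w = "z - (1 / L) *\<^sub>R grad f z"
  have "f xs \<le> f ?w" using assms(3) by (rule minimizers_le)
  also have "\<dots> \<le> f z + inner (grad f z) (?w - z) + L / 2 * (norm (?w - z))\<^sup>2"
    by (rule descent_lemma[OF assms(1,2)])
  also have "\<dots> = f z - (norm (grad f z))\<^sup>2 / (2 * L)"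
    using assms(4)
    by (simp add: power_mult_distrib power2_norm_eq_inner) (simp add: power2_eq_square dot_square_norm field_simps)
  finally show ?thesis using assms(4) by (simp add: field_simps)
qed

lemma grad_minimizer:
  fixes f :: "'v::euclidean_space \<Rightarrow> real"
  assumes "\<And>z. f differentiable (at z)"
    and "\<And>z w. norm (grad f w - grad f z) \<le> L * norm (w - z)"
    and "xs \<in> minimizers f" and "L > 0"
  shows "grad f xs = 0"
  using grad_norm_sq_le[OF assms, of xs] by simp

lemma GDERIV_avg_obj:
  fixes q :: "nat \<Rightarrow> 'v::euclidean_space \<Rightarrow> real"
  assumes "\<And>i. i \<in> H \<Longrightarrow> q i differentiable (at z)"
  shows "GDERIV (avg_obj H q) z :> (1 / real (card H)) *\<^sub>R (\<Sum>i\<in>H. grad (q i) z)"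
proof -
  have "(q i has_derivative (\<lambda>h. inner h (grad (q i) z))) (at z)" if "i \<in> H" for i
    using differentiable_imp_GDERIV_grad[OF assms[OF that]] by (simp add: gderiv_def)
  then have "((\<lambda>z. (1 / real (card H)) * (\<Sum>i\<in>H. q i z)) has_derivative
      (\<lambda>h. (1 / real (card H)) * (\<Sum>i\<in>H. inner h (grad (q i) z)))) (at z)"
    by (intro has_derivative_mult_right has_derivative_sum)
  moreover have "avg_obj H q = (\<lambda>z. (1 / real (card H)) * (\<Sum>i\<in>H. q i z))"
    by (rule ext) (simp add: avg_obj_def)
  ultimately show ?thesis
    by (simp add: gderiv_def inner_sum_right)
qed

section \<open>Surviving foreign vectors against discarded honest ones\<close>

lemma comparative_elimination_facts:
  assumes "comparative_elimination N f d F"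
  shows "F \<subseteq> {..<N}" and "card F = N - f"
    and "\<And>i j. i \<in> F \<Longrightarrow> j < N \<Longrightarrow> j \<notin> F \<Longrightarrow> d i \<le> d j"
proof -
  obtain js where js: "distinct js" "set js = {..<N}" "sorted (map d js)"
    and F: "F = set (take (N - f) js)"
    using assms unfolding comparative_elimination_def by blast
  have len: "length js = N" using js(1,2) distinct_card by fastforce
  show "F \<subseteq> {..<N}" using F js(2) set_take_subset by metis
  show "card F = N - f" using F js(1) len by (simp add: distinct_card)
  fix i j assume "i \<in> F" "j < N" "j \<notin> F"
  \<comment> \<open>A discarded agent stands in the tail behind the cut, after every survivor;
    sortedness across the cut gives the comparison however ties were broken.\<close>
  then have "j \<in> set (drop (N - f) js)"
    using js(2) F by (metis Un_iff append_take_drop_id lessThan_iff set_append)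
  moreover have "sorted (map d (take (N - f) js) @ map d (drop (N - f) js))"
    using js(3) by (metis append_take_drop_id map_append)
  ultimately show "d i \<le> d j"
    using \<open>i \<in> F\<close> F by (auto simp: sorted_append)
qed

lemma sum_exchange_le:
  fixes d :: "'a \<Rightarrow> real"
  assumes "finite A" "finite B" "card A = card B"
    and "\<And>i j. i \<in> A \<Longrightarrow> j \<in> B \<Longrightarrow> d i \<le> d j"
  shows "sum d A \<le> sum d B"
proof -
  obtain h where h: "bij_betw h A B"
    using assms finite_same_card_bij by blast
  then have "sum d A \<le> (\<Sum>i\<in>A. d (h i))"
    using assms(4) by (intro sum_mono) (auto simp: bij_betw_def)
  also have "\<dots> = sum d B" by (rule sum.reindex_bij_betw[OF h])
  finally show ?thesis .
qed

text \<open>Equal size of \<open>F\<close> and \<open>H\<close> means that there are as many foreign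
  survivors as discarded members, and any pairing matches a vector with one at least as long. The
  common part cancels in the first bound, which measures the deviation from honest averaging; the
  second bounds the whole server displacement without losing a constant.\<close>

lemma exchange_bounds:
  fixes \<delta> :: "'a \<Rightarrow> 'v::real_normed_vector"
  assumes "finite F" "finite H" "card F = card H"
    and le: "\<And>i j. i \<in> F - H \<Longrightarrow> j \<in> H - F \<Longrightarrow> norm (\<delta> i) \<le> norm (\<delta> j)"
  shows "norm (sum \<delta> F - sum \<delta> H) \<le> 2 * (\<Sum>j\<in>H - F. norm (\<delta> j))"
    and "norm (sum \<delta> F) \<le> (\<Sum>j\<in>H. norm (\<delta> j))"
proof -
  have c: "card (F - H) = card (H - F)"
    using assms(1-3) by (simp add: card_Diff_subset_Int Int_commute)
  have s: "(\<Sum>j\<in>F - H. norm (\<delta> j)) \<le> (\<Sum>j\<in>H - F. norm (\<delta> j))"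
    using assms c by (intro sum_exchange_le) auto
  have F: "sum \<phi> F = sum \<phi> (F \<inter> H) + sum \<phi> (F - H)"
    and H: "sum \<phi> H = sum \<phi> (F \<inter> H) + sum \<phi> (H - F)"
    for \<phi> :: "'a \<Rightarrow> 'b::comm_monoid_add"
    using sum.Int_Diff[OF assms(1), of \<phi> H] sum.Int_Diff[OF assms(2), of \<phi> F]
    by (auto simp: Int_commute)
  have "norm (sum \<delta> F - sum \<delta> H) = norm (sum \<delta> (F - H) - sum \<delta> (H - F))"
    by (simp add: F[of \<delta>] H[of \<delta>])
  also have "\<dots> \<le> (\<Sum>j\<in>F - H. norm (\<delta> j)) + (\<Sum>j\<in>H - F. norm (\<delta> j))"
    by (intro norm_triangle_le_diff add_mono norm_sum)
  finally show "norm (sum \<delta> F - sum \<delta> H) \<le> 2 * (\<Sum>j\<in>H - F. norm (\<delta> j))" using s by simp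
  have "norm (sum \<delta> F) \<le> (\<Sum>j\<in>F. norm (\<delta> j))" by (rule norm_sum)
  also have "\<dots> \<le> (\<Sum>j\<in>H. norm (\<delta> j))" using s by (simp add: F H)
  finally show "norm (sum \<delta> F) \<le> (\<Sum>j\<in>H. norm (\<delta> j))" .
qed

text \<open>Here \<open>g\<close> stands for the norm of the average gradient, \<open>r\<close> for
  the distance to the minimizer, \<open>Q\<close> for the gap and \<open>D\<close> for the discarded
  honest agents. With \<open>a = L * card D / card H\<close>, the bound on each vector gives
  \<open>m \<le> a * r\<close>, and Cauchy-Schwarz gives \<open>m^2 \<le> 2 * a * Q\<close>. The
  latter suffices once \<open>2 * a \<le> 4 * a - 2 * \<mu>\<close>, that is from
  \<open>a = \<mu>\<close> on; the former works up to this threshold.\<close>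

lemma robust_first_order:
  fixes v :: "'a \<Rightarrow> 'v::real_inner"
  assumes fin: "finite H" "D \<subseteq> H" "H \<noteq> {}" and mu: "0 < \<mu>" and L: "0 < L"
    and lip: "\<And>i. i \<in> H \<Longrightarrow> norm (v i) \<le> L * r"
    and sq: "(\<Sum>i\<in>H. (norm (v i))\<^sup>2) \<le> 2 * L * real (card H) * Q"
    and g: "2 * \<mu> * Q \<le> g\<^sup>2" "0 \<le> g" and Q: "\<mu> * r\<^sup>2 \<le> 2 * Q"
  shows "2 * g * ((\<Sum>j\<in>D. norm (v j)) / real (card H)) - g\<^sup>2
    \<le> (4 * L * (real (card D) / real (card H)) - 2 * \<mu>) * Q"
proof -
  define n where "n = real (card H)"
  define a where "a = L * (real (card D) / n)"
  define m where "m = (\<Sum>j\<in>D. norm (v j)) / n"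
  have n: "n > 0" using fin by (simp add: n_def card_gt_0_iff)
  have a0: "a \<ge> 0" using L n by (simp add: a_def)
  have Q0: "Q \<ge> 0" using Q mu by (smt (verit) mult_nonneg_nonneg zero_le_power2)
  have "2 * g * m - g\<^sup>2 \<le> (4 * a - 2 * \<mu>) * Q"
  proof (cases "a \<le> \<mu>")
    case True
    have "(\<Sum>j\<in>D. norm (v j)) \<le> (\<Sum>j\<in>D. L * r)"
      using lip fin by (intro sum_mono) auto
    then have "m \<le> a * r" using n by (simp add: m_def a_def field_simps)
    then have 1: "2 * g * m \<le> 2 * g * (a * r)"
      using g by (intro mult_left_mono) auto
    \<comment> \<open>The two nonnegative expressions add up exactly to \<open>\<mu>\<close> times
      the claimed difference: the PL inequality has weight \<open>\<mu> - a\<close>, a square and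
      the growth condition have weight \<open>a\<close>, and the terms in \<open>r^2\<close>
      cancel.\<close>
    have "0 \<le> (\<mu> - a) * (g\<^sup>2 - 2 * \<mu> * Q)" using True g by simp
    moreover have "0 \<le> a * ((g - \<mu> * r)\<^sup>2 + \<mu> * (2 * Q - \<mu> * r\<^sup>2))"
      using a0 mu Q by simp
    ultimately have "0 \<le> \<mu> * (g\<^sup>2 - 2 * g * (a * r) + (4 * a - 2 * \<mu>) * Q)"
      by (simp add: algebra_simps power2_eq_square)
    then have "0 \<le> g\<^sup>2 - 2 * g * (a * r) + (4 * a - 2 * \<mu>) * Q"
      using mu by (simp add: zero_le_mult_iff)
    with 1 show ?thesis by simp
  next
    case False
    have "(\<Sum>j\<in>D. norm (v j))\<^sup>2 \<le> real (card D) * (\<Sum>j\<in>D. (norm (v j))\<^sup>2)"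
      using Cauchy_Schwarz_ineq_sum[of "\<lambda>_. 1" "\<lambda>j. norm (v j)" D] by simp
    also have "\<dots> \<le> real (card D) * (2 * L * n * Q)"
      using fin sum_mono2[of H D "\<lambda>j. (norm (v j))\<^sup>2"] sq
      by (intro mult_left_mono) (auto simp: n_def)
    finally have "m\<^sup>2 \<le> real (card D) * (2 * L * n * Q) / n\<^sup>2"
      by (simp add: m_def power_divide divide_right_mono)
    also have "\<dots> = 2 * a * Q" using n by (simp add: a_def power2_eq_square)
    also have "\<dots> \<le> (4 * a - 2 * \<mu>) * Q" using False Q0 by (intro mult_right_mono) auto
    finally have "m\<^sup>2 \<le> (4 * a - 2 * \<mu>) * Q" .
    \<comment> \<open>Maximising \<open>2 * g * m - g^2\<close> over \<open>g\<close> leaves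
      \<open>m^2\<close>, which has just been bounded.\<close>
    moreover have "0 \<le> (g - m)\<^sup>2" by simp
    ultimately show ?thesis by (simp add: power2_eq_square algebra_simps)
  qed
  then show ?thesis by (simp add: a_def m_def n_def mult.assoc)
qed

subsection \<open>One aggregation round along a sample path\<close>

lemma norm_sum_sq_le:
  fixes y :: "'a \<Rightarrow> 'v::real_normed_vector"
  shows "(norm (\<Sum>i\<in>A. y i))\<^sup>2 \<le> real (card A) * (\<Sum>i\<in>A. (norm (y i))\<^sup>2)"
proof -
  have "(norm (\<Sum>i\<in>A. y i))\<^sup>2 \<le> (\<Sum>i\<in>A. norm (y i))\<^sup>2"
    by (intro power_mono norm_sum) auto
  also have "\<dots> \<le> real (card A) * (\<Sum>i\<in>A. (norm (y i))\<^sup>2)"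
    using Cauchy_Schwarz_ineq_sum[of "\<lambda>_. 1" "\<lambda>i. norm (y i)" A] by simp
  finally show ?thesis .
qed

text \<open>Young's inequality with a free weight: \<open>\<eta> = 1\<close> separates the momentum
  into error and gradient, while \<open>\<eta> = \<alpha> k / 2\<close> will keep the loss below the
  contraction of the tracking error.\<close>

lemma norm_add_sq_le:
  fixes a b :: "'v::real_inner"
  assumes "\<eta> > 0"
  shows "(norm (a + b))\<^sup>2 \<le> (1 + \<eta>) * (norm a)\<^sup>2 + (1 + 1 / \<eta>) * (norm b)\<^sup>2"
proof -
  have "0 \<le> (norm (\<eta> *\<^sub>R a - b))\<^sup>2 / \<eta>" using assms by simp
  also have "\<dots> = \<eta> * (norm a)\<^sup>2 - 2 * inner a b + (norm b)\<^sup>2 / \<eta>"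
    using assms unfolding power2_norm_eq_inner
    by (simp add: inner_diff_left inner_diff_right inner_commute field_simps)
  finally show ?thesis
    by (simp add: power2_norm_eq_inner inner_add_left inner_add_right inner_commute algebra_simps)
qed

text \<open>The assumption \<open>xs\<close> is the form in which redundancy enters: one point
  minimises every honest objective, so all \<open>grad (q i)\<close> vanish at it together.\<close>

locale honest_objectives =
  fixes H :: "nat set" and q :: "nat \<Rightarrow> 'v::euclidean_space \<Rightarrow> real" and L :: real and xs :: 'v
  assumes H: "finite H" "H \<noteq> {}"
    and differentiable: "\<And>i z. i \<in> H \<Longrightarrow> q i differentiable (at z)"
    and L: "L > 0"
    and smooth: "\<And>i z w. i \<in> H \<Longrightarrow> norm (grad (q i) w - grad (q i) z) \<le> L * norm (w - z)"
    and xs: "\<And>i. i \<in> H \<Longrightarrow> xs \<in> minimizers (q i)"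
begin

definition gap :: "'v \<Rightarrow> real" where "gap z = avg_obj H q z - avg_obj H q xs"

definition avg :: "(nat \<Rightarrow> real) \<Rightarrow> real" where "avg \<phi> = (1 / real (card H)) * (\<Sum>i\<in>H. \<phi> i)"

lemma card_pos: "real (card H) > 0"
  using H by (simp add: card_gt_0_iff)

lemma avg_mono: "(\<And>i. i \<in> H \<Longrightarrow> \<phi> i \<le> \<psi> i) \<Longrightarrow> avg \<phi> \<le> avg \<psi>"
  unfolding avg_def by (intro mult_left_mono sum_mono) auto

lemma avg_nonneg: "(\<And>i. i \<in> H \<Longrightarrow> 0 \<le> \<phi> i) \<Longrightarrow> 0 \<le> avg \<phi>"
  unfolding avg_def by (intro mult_nonneg_nonneg sum_nonneg) auto

lemma avg_add: "avg (\<lambda>i. \<phi> i + \<psi> i) = avg \<phi> + avg \<psi>"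
  and avg_mult: "avg (\<lambda>i. c * \<phi> i) = c * avg \<phi>"
  and avg_const: "avg (\<lambda>i. c) = c"
  using card_pos
  by (simp_all add: avg_def sum.distrib distrib_left add_divide_distrib flip: sum_distrib_left)

lemma avg_sum: "avg (\<lambda>i. \<Sum>t\<in>A. \<phi> i t) = (\<Sum>t\<in>A. avg (\<lambda>i. \<phi> i t))"
  by (simp add: avg_def sum.swap[of \<phi> A H] sum_divide_distrib)

lemma avg_obj_conv: "avg_obj H q z = avg (\<lambda>i. q i z)"
  by (simp add: avg_obj_def avg_def)

lemma grad_avg: "grad (avg_obj H q) z = (1 / real (card H)) *\<^sub>R (\<Sum>i\<in>H. grad (q i) z)"
  by (rule GDERIV_imp_grad[OF GDERIV_avg_obj[where H = H and q = q and z = z, OF differentiable]])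

lemma avg_differentiable: "avg_obj H q differentiable (at z)"
  using GDERIV_avg_obj[where H = H and q = q and z = z, OF differentiable]
  by (auto simp: gderiv_def intro: differentiableI)

lemma avg_smooth: "norm (grad (avg_obj H q) w - grad (avg_obj H q) z) \<le> L * norm (w - z)"
proof -
  have "norm (grad (avg_obj H q) w - grad (avg_obj H q) z)
      = norm (\<Sum>i\<in>H. grad (q i) w - grad (q i) z) / real (card H)"
    unfolding grad_avg scaleR_diff_right[symmetric] sum_subtractf[symmetric] by simp
  also have "\<dots> \<le> avg (\<lambda>i. norm (grad (q i) w - grad (q i) z))"
    unfolding avg_def using norm_sum[of "\<lambda>i. grad (q i) w - grad (q i) z" H]
    by (simp add: divide_right_mono)
  also have "\<dots> \<le> avg (\<lambda>i. L * norm (w - z))"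
    by (rule avg_mono) (rule smooth)
  finally show ?thesis by (simp add: avg_const)
qed

lemma xs_avg: "xs \<in> minimizers (avg_obj H q)"
  unfolding minimizers_def using minimizers_le[OF xs]
  by (auto simp: is_arg_min_linorder avg_obj_conv intro!: avg_mono)

lemma gap_nonneg: "0 \<le> gap z"
  using minimizers_le[OF xs_avg] by (simp add: gap_def)

lemma grad_xs: "i \<in> H \<Longrightarrow> grad (q i) xs = 0"
  by (rule grad_minimizer[OF differentiable smooth xs L])

lemma norm_grad_le: "i \<in> H \<Longrightarrow> norm (grad (q i) z) \<le> L * norm (z - xs)"
  using smooth[of i z xs] grad_xs by simp

text \<open>Since \<open>xs\<close> minimises each objective separately, the bound of
  \<open>grad_norm_sq_le\<close> can be averaged over the agents. This controls the mean of the
  squares and not only the square of the mean, so the heterogeneity of the agents fades with the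
  gap.\<close>

lemma avg_grad_sq: "avg (\<lambda>i. (norm (grad (q i) z))\<^sup>2) \<le> 2 * L * gap z"
proof -
  have "avg (\<lambda>i. (norm (grad (q i) z))\<^sup>2) \<le> avg (\<lambda>i. 2 * L * (q i z - q i xs))"
    by (rule avg_mono) (rule grad_norm_sq_le[OF differentiable smooth xs L])
  also have "\<dots> = 2 * L * gap z"
    using avg_add[of "\<lambda>i. q i z - q i xs" "\<lambda>i. q i xs"]
    by (simp add: avg_mult gap_def avg_obj_conv)
  finally show ?thesis .
qed

text \<open>Each \<open>y i s\<close> is split into its deviation from \<open>grad (q i) z\<close>
  and that gradient. As any \<open>t \<le> T\<close> is allowed, one bound covers both the local
  drift during a round and the displacement reported at its end.\<close>

lemma avg_drift_le:
  assumes "t \<le> T"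
  shows "avg (\<lambda>i. (norm (b *\<^sub>R (\<Sum>s<t. y i s)))\<^sup>2)
    \<le> b\<^sup>2 * real T * (2 * avg (\<lambda>i. \<Sum>s<T. (norm (y i s - grad (q i) z))\<^sup>2) + 4 * L * real T * gap z)"
proof -
  let ?v = "\<lambda>i. grad (q i) z"
  have "(norm (b *\<^sub>R (\<Sum>s<t. y i s)))\<^sup>2 \<le> (b\<^sup>2 * real T) *
      (2 * (\<Sum>s<T. (norm (y i s - ?v i))\<^sup>2) + 2 * real T * (norm (?v i))\<^sup>2)" for i
  proof -
    have "(norm (\<Sum>s<t. y i s))\<^sup>2 \<le> real t * (\<Sum>s<t. (norm (y i s))\<^sup>2)"
      using norm_sum_sq_le[of "y i" "{..<t}"] by simp
    also have "\<dots> \<le> real T * (\<Sum>s<T. (norm (y i s))\<^sup>2)"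
      using assms by (intro mult_mono sum_mono2 sum_nonneg) auto
    also have "(\<Sum>s<T. (norm (y i s))\<^sup>2) \<le> (\<Sum>s<T. 2 * (norm (y i s - ?v i))\<^sup>2 + 2 * (norm (?v i))\<^sup>2)"
      using norm_add_sq_le[of 1 "y i _ - ?v i" "?v i"] by (intro sum_mono) simp
    also have "\<dots> = 2 * (\<Sum>s<T. (norm (y i s - ?v i))\<^sup>2) + 2 * real T * (norm (?v i))\<^sup>2"
      by (simp add: sum.distrib sum_distrib_left)
    finally show ?thesis
      by (simp add: power_mult_distrib mult.assoc mult_left_mono)
  qed
  then have "avg (\<lambda>i. (norm (b *\<^sub>R (\<Sum>s<t. y i s)))\<^sup>2) \<le> avg (\<lambda>i. (b\<^sup>2 * real T) *
      (2 * (\<Sum>s<T. (norm (y i s - ?v i))\<^sup>2) + 2 * real T * (norm (?v i))\<^sup>2))"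
    by (intro avg_mono)
  also have "\<dots> = b\<^sup>2 * real T * (2 * avg (\<lambda>i. \<Sum>s<T. (norm (y i s - ?v i))\<^sup>2)
      + 2 * real T * avg (\<lambda>i. (norm (?v i))\<^sup>2))"
    by (simp only: avg_mult avg_add)
  also have "\<dots> \<le> b\<^sup>2 * real T * (2 * avg (\<lambda>i. \<Sum>s<T. (norm (y i s - ?v i))\<^sup>2)
      + 2 * real T * (2 * L * gap z))"
    by (intro mult_left_mono add_left_mono avg_grad_sq) auto
  finally show ?thesis by (simp add: mult_ac)
qed

end

text \<open>A single round frozen on one sample path: \<open>z\<close> and \<open>z'\<close> are the
  server points before and after it, \<open>\<delta> i\<close> is the displacement reported by agent
  \<open>i\<close>. Outside \<open>H\<close>, only \<open>eliminated\<close> constrains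
  \<open>\<delta>\<close>, which is all that can be said of an adversary.\<close>

locale aggregation_round = honest_objectives H q L xs
  for H :: "nat set" and q :: "nat \<Rightarrow> 'v::euclidean_space \<Rightarrow> real" and L :: real and xs :: 'v +
  fixes T :: nat and b :: real and y :: "nat \<Rightarrow> nat \<Rightarrow> 'v" and \<delta> :: "nat \<Rightarrow> 'v"
    and z z' :: 'v and F :: "nat set"
  assumes b: "b > 0"
    and honest_step: "\<And>i. i \<in> H \<Longrightarrow> \<delta> i = - b *\<^sub>R (\<Sum>t<T. y i t)"
    and F: "finite F" "card F = card H"
    and eliminated: "\<And>i j. i \<in> F - H \<Longrightarrow> j \<in> H - F \<Longrightarrow> norm (\<delta> i) \<le> norm (\<delta> j)"
    and server_step: "z' = z + (1 / real (card H)) *\<^sub>R (\<Sum>i\<in>F. \<delta> i)"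
begin

definition err :: real where "err = avg (\<lambda>i. \<Sum>t<T. (norm (y i t - grad (q i) z))\<^sup>2)"

lemma server_step_sq_le_avg: "(norm (z' - z))\<^sup>2 \<le> avg (\<lambda>i. (norm (\<delta> i))\<^sup>2)"
proof -
  have "(norm (z' - z))\<^sup>2 = (norm (\<Sum>i\<in>F. \<delta> i))\<^sup>2 / (real (card H))\<^sup>2"
    by (simp add: server_step power_divide)
  also have "\<dots> \<le> (\<Sum>i\<in>H. norm (\<delta> i))\<^sup>2 / (real (card H))\<^sup>2"
    using exchange_bounds(2)[where \<delta> = \<delta>, OF F(1) H(1) F(2) eliminated]
    by (intro divide_right_mono power_mono) auto
  also have "\<dots> \<le> (real (card H) * (\<Sum>i\<in>H. (norm (\<delta> i))\<^sup>2)) / (real (card H))\<^sup>2"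
    using Cauchy_Schwarz_ineq_sum[of "\<lambda>_. 1" "\<lambda>i. norm (\<delta> i)" H]
    by (intro divide_right_mono) auto
  also have "\<dots> = avg (\<lambda>i. (norm (\<delta> i))\<^sup>2)"
    using card_pos by (simp add: avg_def power2_eq_square)
  finally show ?thesis .
qed

lemma server_step_sq_le:
  "(norm (z' - z))\<^sup>2 \<le> b\<^sup>2 * real T * (2 * err + 4 * L * real T * gap z)"
proof -
  have "avg (\<lambda>i. (norm (\<delta> i))\<^sup>2) \<le> avg (\<lambda>i. (norm (b *\<^sub>R (\<Sum>s<T. y i s)))\<^sup>2)"
    using honest_step by (intro avg_mono) simp
  with server_step_sq_le_avg show ?thesis
    unfolding err_def using avg_drift_le[of T T b y z] by linarith
qed

text \<open>The displacement is compared with that of exact honest averaging. The gradients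
  \<open>v i\<close> go to \<open>robust_first_order\<close>, the deviations
  \<open>y i t - v i\<close> are collected in \<open>A\<close>, and a share \<open>\<mu> / 4\<close>
  of the decrease pays for them.\<close>

lemma inner_grad_server_step:
  assumes mu: "\<mu> > 0"
    and PL: "\<mu> * gap z \<le> 1/2 * (norm (grad (avg_obj H q) z))\<^sup>2"
      "\<mu>\<^sup>2 / 2 * (norm (z - xs))\<^sup>2 \<le> \<mu> * gap z"
    and T: "T \<ge> 1"
  shows "inner (grad (avg_obj H q) z) (z' - z)
    \<le> b * real T * ((4 * L * (real (card (F - H)) / real (card H)) - 2 * \<mu>) * gap z)
      + b * (real T * (\<mu> / 4 * gap z) + 18 * (L / \<mu>) * err)"
proof -
  define G where "G = grad (avg_obj H q) z"
  define v where "v i = grad (q i) z" for i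
  define n where "n = real (card H)"
  define A where "A = (\<Sum>i\<in>H. \<Sum>t<T. norm (y i t - v i))"
  define R where "R = sum \<delta> F - sum \<delta> H"
  have n: "n > 0" using card_pos by (simp add: n_def)
  have Gv: "(\<Sum>i\<in>H. v i) = n *\<^sub>R G"
    using n by (simp add: G_def grad_avg v_def n_def)
  have y_sum: "(\<Sum>t<T. y i t) = real T *\<^sub>R v i + (\<Sum>t<T. y i t - v i)" for i
    by (simp add: sum_subtractf scaleR_conv_of_real sum_constant_scaleR)
  have D: "card (H - F) = card (F - H)"
    using F H by (simp add: card_Diff_subset_Int Int_commute)
  have "sum \<delta> H = - b *\<^sub>R (\<Sum>i\<in>H. real T *\<^sub>R v i + (\<Sum>t<T. y i t - v i))"
    unfolding scaleR_sum_right by (intro sum.cong) (simp_all add: honest_step y_sum)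
  also have "\<dots> = - (b * real T * n) *\<^sub>R G - b *\<^sub>R (\<Sum>i\<in>H. \<Sum>t<T. y i t - v i)"
    by (simp add: sum.distrib Gv scaleR_add_right flip: scaleR_sum_right)
  finally have "inner G (sum \<delta> H) = - (b * real T * n) * (norm G)\<^sup>2
      - b * inner G (\<Sum>i\<in>H. \<Sum>t<T. y i t - v i)"
    by (simp add: inner_diff_right power2_norm_eq_inner)
  moreover have "- inner G (\<Sum>i\<in>H. \<Sum>t<T. y i t - v i) \<le> norm G * A"
  proof -
    have "norm (\<Sum>i\<in>H. \<Sum>t<T. y i t - v i) \<le> A"
      unfolding A_def by (intro sum_norm_le norm_sum)
    then have "norm G * norm (\<Sum>i\<in>H. \<Sum>t<T. y i t - v i) \<le> norm G * A"
      by (intro mult_left_mono) auto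
    moreover have "\<bar>inner G (\<Sum>i\<in>H. \<Sum>t<T. y i t - v i)\<bar>
        \<le> norm G * norm (\<Sum>i\<in>H. \<Sum>t<T. y i t - v i)"
      by (rule Cauchy_Schwarz_ineq2)
    ultimately show ?thesis by linarith
  qed
  then have "b * (- inner G (\<Sum>i\<in>H. \<Sum>t<T. y i t - v i)) \<le> b * (norm G * A)"
    using b by (intro mult_left_mono) auto
  ultimately have honest: "inner G (sum \<delta> H) \<le> - (b * real T * n) * (norm G)\<^sup>2 + b * (norm G * A)"
    by simp
  have "norm (\<delta> j) \<le> b * (real T * norm (v j) + (\<Sum>t<T. norm (y j t - v j)))" if "j \<in> H" for j
  proof -
    have "norm (\<delta> j) = b * norm (real T *\<^sub>R v j + (\<Sum>t<T. y j t - v j))"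
      using that b by (simp add: honest_step y_sum)
    also have "norm (real T *\<^sub>R v j + (\<Sum>t<T. y j t - v j))
        \<le> real T * norm (v j) + (\<Sum>t<T. norm (y j t - v j))"
      by (intro norm_triangle_le add_mono norm_sum) simp
    finally show ?thesis using b by (simp add: mult_left_mono)
  qed
  then have "(\<Sum>j\<in>H - F. norm (\<delta> j))
      \<le> (\<Sum>j\<in>H - F. b * (real T * norm (v j) + (\<Sum>t<T. norm (y j t - v j))))"
    by (intro sum_mono) auto
  also have "\<dots> = b * (real T * (\<Sum>j\<in>H - F. norm (v j)) + (\<Sum>j\<in>H - F. \<Sum>t<T. norm (y j t - v j)))"
    by (simp only: sum.distrib sum_distrib_left distrib_left)
  \<comment> \<open>The errors of the discarded agents are enlarged to those of all of
    \<open>H\<close>, so that the single quantity \<open>A\<close> serves the honest and the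
    Byzantine part.\<close>
  also have "\<dots> \<le> b * (real T * (\<Sum>j\<in>H - F. norm (v j)) + A)"
    unfolding A_def using b H
    by (intro mult_left_mono add_left_mono sum_mono2) (auto intro: sum_nonneg)
  finally have "norm R \<le> 2 * (b * (real T * (\<Sum>j\<in>H - F. norm (v j)) + A))"
    using exchange_bounds(1)[where \<delta> = \<delta>, OF F(1) H(1) F(2) eliminated] by (simp add: R_def)
  then have "norm G * norm R \<le> norm G * (2 * (b * (real T * (\<Sum>j\<in>H - F. norm (v j)) + A)))"
    by (intro mult_left_mono) auto
  then have byz: "inner G R \<le> norm G * (2 * (b * (real T * (\<Sum>j\<in>H - F. norm (v j)) + A)))"
    using norm_cauchy_schwarz[of G R] by linarith
  have "inner G (z' - z) = (inner G (sum \<delta> H) + inner G R) / n"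
    by (simp add: server_step R_def n_def inner_diff_right)
  also have "\<dots> \<le> (- (b * real T * n) * (norm G)\<^sup>2 + b * (norm G * A)
      + norm G * (2 * (b * (real T * (\<Sum>j\<in>H - F. norm (v j)) + A)))) / n"
    using honest byz n by (intro divide_right_mono) auto
  \<comment> \<open>The coefficient 3 is one \<open>A\<close> from the honest mean and two from the
    exchange.\<close>
  also have "\<dots> = b * real T * (2 * norm G * ((\<Sum>j\<in>H - F. norm (v j)) / n) - (norm G)\<^sup>2)
      + b * (3 * norm G * (A / n))"
    using n by (simp add: field_simps)
  also have "\<dots> \<le> b * real T * ((4 * L * (real (card (H - F)) / n) - 2 * \<mu>) * gap z)
      + b * (real T * (\<mu> / 4 * gap z) + 18 * (L / \<mu>) * err)"
  proof (intro add_mono mult_left_mono)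
    have "\<mu> * (\<mu> * (norm (z - xs))\<^sup>2) \<le> \<mu> * (2 * gap z)"
      using PL(2) by (simp add: power2_eq_square)
    then have "\<mu> * (norm (z - xs))\<^sup>2 \<le> 2 * gap z" using mu by simp
    moreover have "(\<Sum>i\<in>H. (norm (v i))\<^sup>2) \<le> 2 * L * real (card H) * gap z"
      using avg_grad_sq[of z] card_pos unfolding avg_def v_def by (simp add: field_simps)
    ultimately show "2 * norm G * ((\<Sum>j\<in>H - F. norm (v j)) / n) - (norm G)\<^sup>2
        \<le> (4 * L * (real (card (H - F)) / n) - 2 * \<mu>) * gap z"
      unfolding n_def using mu L H PL(1)
      by (intro robust_first_order[where r = "norm (z - xs)"])
        (auto simp: v_def norm_grad_le G_def)
    have g: "(norm G)\<^sup>2 \<le> 2 * L * gap z"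
      unfolding G_def gap_def
      by (rule grad_norm_sq_le[OF avg_differentiable avg_smooth xs_avg L])
    have "A\<^sup>2 \<le> n * (\<Sum>i\<in>H. (\<Sum>t<T. norm (y i t - v i))\<^sup>2)"
      using norm_sum_sq_le[of "\<lambda>i. \<Sum>t<T. norm (y i t - v i)" H] by (simp add: A_def n_def)
    also have "\<dots> \<le> n * (\<Sum>i\<in>H. real T * (\<Sum>t<T. (norm (y i t - v i))\<^sup>2))"
      using norm_sum_sq_le[of "\<lambda>t. norm (y _ t - v _)" "{..<T}"] n
      by (intro mult_left_mono sum_mono) auto
    also have "\<dots> = n\<^sup>2 * (real T * err)"
      using n by (simp add: err_def avg_def v_def n_def power2_eq_square sum_distrib_left)
    finally have A: "(A / n)\<^sup>2 \<le> real T * err"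
      using n by (simp add: power_divide field_simps)
    \<comment> \<open>Young weight tuned so that \<open>2 * L * c\<close> equals
      \<open>T * \<mu> / 4\<close>, the share of the decrease set aside; then
      \<open>9 / (4 * c)\<close> times \<open>T\<close> is \<open>18 * L / \<mu>\<close>.\<close>
    define c where "c = real T * \<mu> / (8 * L)"
    have c: "c > 0" using T mu L by (simp add: c_def)
    have "0 \<le> c * (norm G - 3 / (2 * c) * (A / n))\<^sup>2" using c by simp
    also have "\<dots> = c * (norm G)\<^sup>2 - 3 * norm G * (A / n) + 9 / (4 * c) * (A / n)\<^sup>2"
      using c by (simp add: power2_eq_square algebra_simps)
    finally have "3 * norm G * (A / n) \<le> c * (norm G)\<^sup>2 + 9 / (4 * c) * (A / n)\<^sup>2" by simp
    also have "\<dots> \<le> c * (2 * L * gap z) + 9 / (4 * c) * (real T * err)"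
      using c g A by (intro add_mono mult_left_mono) auto
    also have "\<dots> = real T * (\<mu> / 4 * gap z) + 18 * (L / \<mu>) * err"
      using T mu L by (simp add: c_def field_simps)
    finally show "3 * norm G * (A / n) \<le> real T * (\<mu> / 4 * gap z) + 18 * (L / \<mu>) * err" .
  qed (use b in auto)
  finally show ?thesis by (simp add: G_def n_def D)
qed

lemma gap_step:
  assumes "\<mu> > 0"
    and "\<mu> * gap z \<le> 1/2 * (norm (grad (avg_obj H q) z))\<^sup>2"
      "\<mu>\<^sup>2 / 2 * (norm (z - xs))\<^sup>2 \<le> \<mu> * gap z"
    and "T \<ge> 1"
  shows "gap z' \<le> gap z
      + b * real T * ((4 * L * (real (card (F - H)) / real (card H)) - 2 * \<mu>) * gap z)
      + b * (real T * (\<mu> / 4 * gap z) + 18 * (L / \<mu>) * err)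
      + L / 2 * (b\<^sup>2 * real T * (2 * err + 4 * L * real T * gap z))"
proof -
  have "gap z' \<le> gap z + inner (grad (avg_obj H q) z) (z' - z) + L / 2 * (norm (z' - z))\<^sup>2"
    using descent_lemma[OF avg_differentiable avg_smooth, of z' z] by (simp add: gap_def)
  moreover have "L / 2 * (norm (z' - z))\<^sup>2
      \<le> L / 2 * (b\<^sup>2 * real T * (2 * err + 4 * L * real T * gap z))"
    using L server_step_sq_le by (intro mult_left_mono) auto
  ultimately show ?thesis using inner_grad_server_step[OF assms] by linarith
qed

text \<open>The vectors \<open>u i\<close> stay fixed; only the point at which the gradients are
  taken moves from \<open>z\<close> to \<open>z'\<close>. By smoothness the move costs
  \<open>L^2\<close> times the squared server displacement.\<close>

lemma tracking_step:
  assumes "\<eta> > 0"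
  shows "avg (\<lambda>i. (norm (u i - grad (q i) z'))\<^sup>2)
    \<le> (1 + \<eta>) * avg (\<lambda>i. (norm (u i - grad (q i) z))\<^sup>2)
      + (1 + 1 / \<eta>) * L\<^sup>2 * (b\<^sup>2 * real T * (2 * err + 4 * L * real T * gap z))"
proof -
  have "(norm (u i - grad (q i) z'))\<^sup>2
      \<le> (1 + \<eta>) * (norm (u i - grad (q i) z))\<^sup>2 + (1 + 1 / \<eta>) * L\<^sup>2 * (norm (z' - z))\<^sup>2"
    if "i \<in> H" for i
  proof -
    have "(norm (u i - grad (q i) z'))\<^sup>2 \<le> (1 + \<eta>) * (norm (u i - grad (q i) z))\<^sup>2
        + (1 + 1 / \<eta>) * (norm (grad (q i) z - grad (q i) z'))\<^sup>2"
      using norm_add_sq_le[OF assms, of "u i - grad (q i) z" "grad (q i) z - grad (q i) z'"]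
      by (simp only: diff_add_cancel add_diff_eq)
    moreover have "(norm (grad (q i) z - grad (q i) z'))\<^sup>2 \<le> (L * norm (z - z'))\<^sup>2"
      using smooth[OF that] by (intro power_mono) auto
    then have "(1 + 1 / \<eta>) * (norm (grad (q i) z - grad (q i) z'))\<^sup>2 \<le> (1 + 1 / \<eta>) * (L * norm (z - z'))\<^sup>2"
      using assms by (intro mult_left_mono) auto
    moreover have "(1 + 1 / \<eta>) * (L * norm (z - z'))\<^sup>2 = (1 + 1 / \<eta>) * L\<^sup>2 * (norm (z' - z))\<^sup>2"
      by (simp only: power_mult_distrib norm_minus_commute[of z z'] mult.assoc)
    ultimately show ?thesis by linarith
  qed
  then have "avg (\<lambda>i. (norm (u i - grad (q i) z'))\<^sup>2) \<le> avg (\<lambda>i. (1 + \<eta>) * (norm (u i - grad (q i) z))\<^sup>2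
      + (1 + 1 / \<eta>) * L\<^sup>2 * (norm (z' - z))\<^sup>2)"
    by (rule avg_mono)
  also have "\<dots> = (1 + \<eta>) * avg (\<lambda>i. (norm (u i - grad (q i) z))\<^sup>2) + (1 + 1 / \<eta>) * L\<^sup>2 * (norm (z' - z))\<^sup>2"
    by (simp only: avg_add avg_mult avg_const)
  also have "(1 + 1 / \<eta>) * L\<^sup>2 * (norm (z' - z))\<^sup>2
      \<le> (1 + 1 / \<eta>) * L\<^sup>2 * (b\<^sup>2 * real T * (2 * err + 4 * L * real T * gap z))"
    using assms server_step_sq_le by (intro mult_left_mono) auto
  finally show ?thesis by simp
qed

end

subsection \<open>The scalar recursion of one round\<close>

text \<open>Bookkeeping for one round: \<open>Q\<close> is the expected gap, \<open>a0\<close> and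
  \<open>aT\<close> the tracking error at both ends of the local steps, \<open>S\<close> its sum
  over them, \<open>X\<close> the drift bound and \<open>s\<close> the noise variance. In units of
  \<open>\<mu> * b * T\<close>, the decrease 2 of the gap has lost 1/4 to the gradient error and
  must keep 3/2; all further cross terms have to fit into the remaining 1/4 or into half of the
  contraction \<open>a\<close> of the tracking error.\<close>

lemma round_recursion:
  fixes \<mu> L T a b s a0 S Q aT :: real
  defines "X \<equiv> b\<^sup>2 * T * (2 * S + 4 * L * T * Q)"
  assumes mu: "0 < \<mu>" "\<mu> \<le> L" and T: "1 \<le> T" and a: "0 < a" "a \<le> 1" and b: "0 < b"
    and ratio: "b / a \<le> \<mu>\<^sup>2 / (12^4 * (L + 1)^4 * T\<^sup>2)"
    and nonneg: "0 \<le> a0" "0 \<le> S" "0 \<le> Q" "0 \<le> s"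
    and S: "S \<le> T * a0 + T\<^sup>2 * (a * L\<^sup>2 * X + a\<^sup>2 * s)"
    and aT: "aT \<le> (1 - a) * a0 + T * (a * L\<^sup>2 * X + a\<^sup>2 * s)"
  shows "Q - 2 * \<mu> * b * T * Q + b * (T * (\<mu> / 4 * Q) + 18 * (L / \<mu>) * S) + L / 2 * X
      + ((1 + a / 2) * aT + (1 + 1 / (a / 2)) * L\<^sup>2 * X)
    \<le> (1 - 3 / 2 * \<mu> * T * b) * (Q + a0) + 150 * T * s * a\<^sup>2"
proof -
  define c :: real where "c = 1 / 12^4"
  have c: "0 < c" "c \<le> 1 / 1000" by (simp_all add: c_def)
  have L: "0 < L" using mu by simp
  have TT: "T \<le> T\<^sup>2" using T by (simp add: power2_eq_square)
  \<comment> \<open>Trading device: the factor \<open>(L + 1)^4\<close> of the ratio pays for the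
    monomial \<open>m\<close>, and \<open>\<mu>^2\<close> is what remains to be matched by
    \<open>k\<close>. Taking \<open>k = \<mu>\<close> or \<open>k = \<mu>^2\<close> leaves a power
    of \<open>\<mu>\<close> on the right, needed where the bound competes with
    \<open>b * \<mu> * T\<close> or a division by \<open>\<mu>\<close> must cancel.\<close>
  have key: "b * T\<^sup>2 * m \<le> c * a * k" if "m * \<mu>\<^sup>2 \<le> (L + 1)^4 * k" and k: "0 \<le> k" for m k
  proof -
    have "b * (12^4 * (L + 1)^4 * T\<^sup>2) \<le> a * \<mu>\<^sup>2"
      using ratio a T L by (simp add: field_simps)
    then have 1: "b * T\<^sup>2 * (L + 1)^4 \<le> c * a * \<mu>\<^sup>2" by (simp add: c_def field_simps)
    have "b * T\<^sup>2 * (m * \<mu>\<^sup>2) \<le> b * T\<^sup>2 * ((L + 1)^4 * k)"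
      using that(1) b by (intro mult_left_mono) auto
    also have "\<dots> = b * T\<^sup>2 * (L + 1)^4 * k" by simp
    also have "\<dots> \<le> c * a * \<mu>\<^sup>2 * k" using 1 k by (rule mult_right_mono)
    finally have "b * T\<^sup>2 * m * \<mu>\<^sup>2 \<le> c * a * k * \<mu>\<^sup>2" by (simp add: mult_ac)
    then show ?thesis using mu by simp
  qed
  have pw: "L ^ i * \<mu> ^ j \<le> (L + 1) ^ 4" if "i + j \<le> 4" for i j
  proof -
    have "L ^ i * \<mu> ^ j \<le> (L + 1) ^ i * (L + 1) ^ j"
      using mu L by (intro mult_mono power_mono) auto
    also have "\<dots> \<le> (L + 1) ^ 4"
      unfolding power_add[symmetric] using L that by (intro power_increasing) auto
    finally show ?thesis .
  qed
  have k1: "b * T\<^sup>2 \<le> c * a"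
    using key[of 1 1] pw[of 0 2] by simp
  have k\<mu>: "b * T\<^sup>2 * \<mu> \<le> c * a"
    using key[of \<mu> 1] pw[of 0 3] by (simp add: power3_eq_cube power2_eq_square)
  have kL: "b * T\<^sup>2 * L \<le> c * a"
    using key[of L 1] pw[of 1 2] by simp
  have kL2: "b * T\<^sup>2 * L\<^sup>2 \<le> c * a"
    using key[of "L\<^sup>2" 1] pw[of 2 2] by simp
  have key\<mu>: "b * T\<^sup>2 * m \<le> c * a * \<mu>" if "m * \<mu> \<le> (L + 1)^4" for m
    using key[of m \<mu>] mu mult_right_mono[OF that, of \<mu>] by (simp add: power2_eq_square mult.assoc)
  have kL\<mu>: "b * T\<^sup>2 * L \<le> c * a * \<mu>"
    using key\<mu>[of L] pw[of 1 1] by simp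
  have kL2\<mu>: "b * T\<^sup>2 * L\<^sup>2 \<le> c * a * \<mu>"
    using key\<mu>[of "L\<^sup>2"] pw[of 2 1] by simp
  have kL3\<mu>: "b * T\<^sup>2 * L^3 \<le> c * a * \<mu>"
    using key\<mu>[of "L^3"] pw[of 3 1] by simp
  have kL4: "b * T\<^sup>2 * L^4 \<le> c * a * \<mu>\<^sup>2"
    using key[of "L^4" "\<mu>\<^sup>2"] pw[of 4 0] mult_right_mono[of "L^4" "(L+1)^4" "\<mu>\<^sup>2"] by simp
  define w where "w = (b * T\<^sup>2 * L^3) * (b * T\<^sup>2)"
  have ca: "c * a \<le> c" "c * a * \<mu> \<le> c * \<mu>" "c * a * \<mu>\<^sup>2 \<le> c * \<mu>\<^sup>2"
    using c a mu by (simp_all add: mult_left_le)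
  have w0: "0 \<le> w" using b L by (simp add: w_def)
  have k1c: "b * T\<^sup>2 \<le> c" and kL2c: "b * T\<^sup>2 * L\<^sup>2 \<le> c"
    and kL3c: "b * T\<^sup>2 * L^3 \<le> c * \<mu>" and kL4c: "b * T\<^sup>2 * L^4 \<le> c * \<mu>\<^sup>2"
    using k1 kL2 kL3\<mu> kL4 ca by linarith+
  have w: "w \<le> c * \<mu> * c"
    unfolding w_def by (rule mult_mono[OF kL3c k1c]) (use c mu b in auto)
  have Lw: "L * w \<le> c * \<mu>\<^sup>2 * c"
  proof -
    have "L * w = (b * T\<^sup>2 * L^4) * (b * T\<^sup>2)"
      by (simp add: w_def power4_eq_xxxx power3_eq_cube)
    also have "\<dots> \<le> c * \<mu>\<^sup>2 * c"
      by (rule mult_mono[OF kL4c k1c]) (use c b in auto)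
    finally show ?thesis .
  qed
  \<comment> \<open>\<open>X\<close> contains \<open>S\<close> again. Its coefficient is at most
    1/2, so it is absorbed on the left and the rest doubles; \<open>w\<close> is what then stands in
    front of \<open>Q\<close>.\<close>
  have S': "S \<le> 2 * (T * a0 + T\<^sup>2 * (a\<^sup>2 * s)) + 8 * w * Q"
  proof -
    have eq: "T\<^sup>2 * (a * L\<^sup>2 * X)
        = 2 * a * ((b * T\<^sup>2 * L\<^sup>2) * (b * T)) * S + 4 * a * w * Q"
      by (simp add: X_def w_def power2_eq_square power3_eq_cube algebra_simps)
    have "b * T \<le> b * T\<^sup>2" using TT b by simp
    then have "b * T \<le> c" using k1c by linarith
    with kL2c have "(b * T\<^sup>2 * L\<^sup>2) * (b * T) \<le> c * c"
      by (rule mult_mono) (use c b T in auto)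
    with a(2) have "a * ((b * T\<^sup>2 * L\<^sup>2) * (b * T)) \<le> 1 * (c * c)"
      by (rule mult_mono) (use b T in auto)
    then have "2 * a * ((b * T\<^sup>2 * L\<^sup>2) * (b * T)) * S \<le> 2 * (c * c) * S"
      using nonneg by (intro mult_right_mono) auto
    moreover have "c * c \<le> 1 / 4" using c mult_mono[of c "1/2" c "1/2"] by simp
    then have "2 * (c * c) * S \<le> 1 / 2 * S"
      using nonneg by (intro mult_right_mono) auto
    moreover have "4 * a * w * Q \<le> 4 * 1 * w * Q"
      using a w0 nonneg by (intro mult_right_mono mult_left_mono) auto
    ultimately show ?thesis using S eq by (simp add: algebra_simps)
  qed
  \<comment> \<open>\<open>K\<close> collects the three places where drift enters: the tracking
    recursion inside the round, the second-order term of the descent lemma, and the change of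
    reference point, whose \<open>1 / a\<close> is cancelled by the \<open>a\<close> that the ratio
    provides.\<close>
  define K where "K = (1 + a / 2) * (T * (a * L\<^sup>2)) + L / 2 + (1 + 1 / (a / 2)) * L\<^sup>2"
  have a3: "1 + 1 / (a / 2) \<le> 3 / a" using a by (simp add: field_simps)
  have K0: "0 \<le> K" using a L T by (simp add: K_def)
  have T0: "b * T * m \<le> b * T\<^sup>2 * m" if "0 \<le> m" for m
    using TT b that by (intro mult_right_mono mult_left_mono) auto
  have KS: "K * b\<^sup>2 * T \<le> 5 * c * b"
  proof -
    have "(1 + a / 2) * (T * (a * L\<^sup>2)) * b\<^sup>2 * T = ((1 + a / 2) * a) * (b * T\<^sup>2 * L\<^sup>2) * b"
      by (simp add: power2_eq_square)
    also have "\<dots> \<le> (3 / 2 * 1) * c * b"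
      by (intro mult_right_mono mult_mono[OF _ kL2c] mult_mono[of _ "3/2"]) (use a b c in auto)
    finally have 1: "(1 + a / 2) * (T * (a * L\<^sup>2)) * b\<^sup>2 * T \<le> 3 / 2 * c * b" by simp
    have "L / 2 * b\<^sup>2 * T = 1 / 2 * (b * T * L) * b" by (simp add: power2_eq_square)
    also have "\<dots> \<le> 1 / 2 * c * b"
    proof (intro mult_right_mono mult_left_mono)
      show "b * T * L \<le> c" using T0[of L] kL ca L by linarith
    qed (use b in auto)
    finally have 2: "L / 2 * b\<^sup>2 * T \<le> 1 / 2 * c * b" .
    have "(1 + 1 / (a / 2)) * L\<^sup>2 * b\<^sup>2 * T = (1 + 1 / (a / 2)) * (b * T * L\<^sup>2) * b"
      by (simp add: power2_eq_square)
    also have "\<dots> \<le> (3 / a) * (c * a) * b"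
    proof (intro mult_right_mono mult_mono[OF a3])
      show "b * T * L\<^sup>2 \<le> c * a" using T0[of "L\<^sup>2"] kL2 by simp
    qed (use a b T in auto)
    finally have 3: "(1 + 1 / (a / 2)) * L\<^sup>2 * b\<^sup>2 * T \<le> 3 * c * b" using a by simp
    from 1 2 3 show ?thesis by (simp add: K_def algebra_simps)
  qed
  have KQ: "K * b\<^sup>2 * T\<^sup>2 * L \<le> 5 * c * (b * \<mu> * T)"
  proof -
    have "(1 + a / 2) * (T * (a * L\<^sup>2)) * b\<^sup>2 * T\<^sup>2 * L = ((1 + a / 2) * a) * (b * T\<^sup>2 * L^3) * (b * T)"
      by (simp add: power2_eq_square power3_eq_cube)
    also have "\<dots> \<le> (3 / 2 * 1) * (c * \<mu>) * (b * T)"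
      by (intro mult_right_mono mult_mono[OF _ kL3c] mult_mono[of _ "3/2"]) (use a b T L in auto)
    finally have 1: "(1 + a / 2) * (T * (a * L\<^sup>2)) * b\<^sup>2 * T\<^sup>2 * L \<le> 3 / 2 * c * (b * \<mu> * T)" by (simp add: mult_ac)
    have "L / 2 * b\<^sup>2 * T\<^sup>2 * L = 1 / 2 * (b * T\<^sup>2 * L\<^sup>2) * b" by (simp add: power2_eq_square)
    also have "\<dots> \<le> 1 / 2 * (c * \<mu>) * b"
    proof (intro mult_right_mono mult_left_mono)
      show "b * T\<^sup>2 * L\<^sup>2 \<le> c * \<mu>" using kL2\<mu> ca by linarith
    qed (use b in auto)
    also have "\<dots> \<le> 1 / 2 * (c * \<mu>) * (b * T)"
      using T b c mu by (intro mult_left_mono) auto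
    finally have 2: "L / 2 * b\<^sup>2 * T\<^sup>2 * L \<le> 1 / 2 * c * (b * \<mu> * T)" by (simp add: mult_ac)
    have "(1 + 1 / (a / 2)) * L\<^sup>2 * b\<^sup>2 * T\<^sup>2 * L = (1 + 1 / (a / 2)) * (b * T\<^sup>2 * L^3) * b"
      by (simp add: power2_eq_square power3_eq_cube)
    also have "\<dots> \<le> (3 / a) * (c * a * \<mu>) * b"
      by (intro mult_right_mono mult_mono[OF a3 kL3\<mu>]) (use a b L in auto)
    also have "\<dots> = 3 * c * \<mu> * b" using a by simp
    also have "\<dots> \<le> 3 * c * \<mu> * (b * T)"
      using T b c mu by (intro mult_left_mono) auto
    finally have 3: "(1 + 1 / (a / 2)) * L\<^sup>2 * b\<^sup>2 * T\<^sup>2 * L \<le> 3 * c * (b * \<mu> * T)" by (simp add: mult_ac)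
    from 1 2 3 show ?thesis by (simp add: K_def algebra_simps)
  qed
  have KX: "K * X \<le> 10 * c * b * S + 20 * c * (b * \<mu> * T) * Q"
  proof -
    have "K * X = 2 * (K * b\<^sup>2 * T) * S + 4 * (K * b\<^sup>2 * T\<^sup>2 * L) * Q"
      by (simp add: X_def power2_eq_square algebra_simps)
    also have "\<dots> \<le> 2 * (5 * c * b) * S + 4 * (5 * c * (b * \<mu> * T)) * Q"
      using KS KQ nonneg by (intro add_mono mult_right_mono mult_left_mono) auto
    finally show ?thesis by simp
  qed
  \<comment> \<open>The total coefficient of \<open>S\<close>. The noise part of \<open>S\<close>
    carries \<open>T^2\<close>, and the bound on \<open>k * T^2\<close> swallows it; this keeps a
    factor T out of the final noise term.\<close>
  define k where "k = 10 * c * b + 18 * (L / \<mu>) * b"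
  have k0: "0 \<le> k" using c b L mu by (simp add: k_def)
  have kT2: "k * T\<^sup>2 \<le> 28 * (c * a)"
  proof -
    have "10 * c * b * T\<^sup>2 \<le> 10 * 1 * (c * a)"
      using mult_mono[of "10 * c" "10 * 1" "b * T\<^sup>2" "c * a"] c k1 b by (simp add: mult.assoc)
    moreover have "18 * (L / \<mu>) * b * T\<^sup>2 = 18 * (b * T\<^sup>2 * L) / \<mu>" by simp
    moreover have "18 * (b * T\<^sup>2 * L) / \<mu> \<le> 18 * (c * a * \<mu>) / \<mu>"
      using kL\<mu> mu by (intro divide_right_mono) auto
    ultimately show ?thesis using mu by (simp add: k_def algebra_simps)
  qed
  have kT: "k * T \<le> 28 * (c * a)"
    using kT2 mult_left_mono[OF TT k0] by linarith
  have kw: "k * (8 * w) \<le> 1 / 10 * (b * \<mu> * T)"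
  proof -
    have "10 * c * b * (8 * w) \<le> 10 * c * b * (8 * (c * \<mu> * c))"
      using w c b by (intro mult_left_mono) auto
    moreover have "18 * (L / \<mu>) * b * (8 * w) = 144 * b / \<mu> * (L * w)" by simp
    moreover have "144 * b / \<mu> * (L * w) \<le> 144 * b / \<mu> * (c * \<mu>\<^sup>2 * c)"
      using Lw b mu by (intro mult_left_mono) auto
    moreover have "144 * b / \<mu> * (c * \<mu>\<^sup>2 * c) = 144 * (c * c) * (b * \<mu>)"
      using mu by (simp add: power2_eq_square)
    ultimately have "k * (8 * w) \<le> (80 * (c * c * c) + 144 * (c * c)) * (b * \<mu>)"
      by (simp add: k_def algebra_simps)
    also have "\<dots> \<le> 1 / 10 * (b * \<mu> * T)"
    proof -
      have "80 * (c * c * c) + 144 * (c * c) \<le> 1 / 10" by (simp add: c_def)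
      moreover have "b * \<mu> \<le> b * \<mu> * T" using b mu T by simp
      ultimately show ?thesis by (rule mult_mono) (use b mu in auto)
    qed
    finally show ?thesis .
  qed
  have kS: "k * S \<le> 56 * (c * a) * a0 + 56 * (c * a) * (a\<^sup>2 * s) + 1 / 10 * (b * \<mu> * T) * Q"
  proof -
    have "k * S \<le> k * (2 * (T * a0 + T\<^sup>2 * (a\<^sup>2 * s)) + 8 * w * Q)"
      using S' k0 by (rule mult_left_mono)
    also have "\<dots> = 2 * (k * T) * a0 + 2 * (k * T\<^sup>2) * (a\<^sup>2 * s) + k * (8 * w) * Q"
      by (simp add: algebra_simps)
    also have "\<dots> \<le> 2 * (28 * (c * a)) * a0 + 2 * (28 * (c * a)) * (a\<^sup>2 * s) + 1 / 10 * (b * \<mu> * T) * Q"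
      using kT kT2 kw nonneg by (intro add_mono mult_right_mono mult_left_mono) auto
    finally show ?thesis by simp
  qed
  have "(1 + a / 2) * aT \<le> (1 + a / 2) * ((1 - a) * a0 + T * (a * L\<^sup>2 * X + a\<^sup>2 * s))"
    using aT a by (intro mult_left_mono) auto
  then have "Q - 2 * \<mu> * b * T * Q + b * (T * (\<mu> / 4 * Q) + 18 * (L / \<mu>) * S) + L / 2 * X
      + ((1 + a / 2) * aT + (1 + 1 / (a / 2)) * L\<^sup>2 * X)
    \<le> Q - 7 / 4 * (b * \<mu> * T) * Q + 18 * (L / \<mu>) * b * S + K * X
      + (1 + a / 2) * (1 - a) * a0 + (1 + a / 2) * (T * (a\<^sup>2 * s))"
    by (simp add: K_def algebra_simps add_divide_distrib diff_divide_distrib)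
  also have "\<dots> \<le> Q - 7 / 4 * (b * \<mu> * T) * Q + k * S + 20 * c * (b * \<mu> * T) * Q
      + (1 + a / 2) * (1 - a) * a0 + (1 + a / 2) * (T * (a\<^sup>2 * s))"
    using KX by (simp add: k_def algebra_simps)
  \<comment> \<open>Final budget: the spare 1/4 of \<open>b * \<mu> * T * Q\<close> meets 1/50 and
    1/10; the spare \<open>a / 2\<close> of \<open>a0\<close> meets two terms of size
    \<open>a / 10\<close>; the noise adds up to \<open>3 * T * s * a^2\<close>, well within the
    coefficient 150.\<close>
  also have "\<dots> \<le> (1 - 3 / 2 * \<mu> * T * b) * (Q + a0) + 150 * T * s * a\<^sup>2"
  proof -
    have bQ: "20 * c * (b * \<mu> * T) * Q \<le> 1 / 50 * (b * \<mu> * T) * Q"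
      using c b mu T nonneg by (intro mult_right_mono) auto
    have "0 \<le> b * \<mu> * T * Q" using b mu T nonneg by simp
    have caa: "c * a \<le> 1 / 1000 * a" using c a by (intro mult_right_mono) auto
    then have "56 * (c * a) \<le> 1 / 10 * a" using a by linarith
    then have e: "56 * (c * a) * a0 \<le> 1 / 10 * a * a0"
      using nonneg(1) by (rule mult_right_mono)
    have "b * \<mu> * T \<le> c * a"
      using order.trans[OF T0[OF less_imp_le[OF mu(1)]] k\<mu>] by (simp add: mult_ac)
    then have "3 / 2 * (b * \<mu> * T) \<le> 1 / 10 * a" using caa a by linarith
    then have f: "3 / 2 * (b * \<mu> * T) * a0 \<le> 1 / 10 * a * a0"
      using nonneg(1) by (rule mult_right_mono)
    have "(1 + a / 2) * (1 - a) \<le> 1 - a / 2" using a by (simp add: algebra_simps)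
    then have g: "(1 + a / 2) * (1 - a) * a0 \<le> (1 - a / 2) * a0"
      using nonneg by (intro mult_right_mono)
    have "0 \<le> a * a0" using a nonneg by simp
    have s0: "0 \<le> a\<^sup>2 * s" using nonneg by simp
    then have s1: "a\<^sup>2 * s \<le> T * (a\<^sup>2 * s)" using mult_right_mono[OF T s0] by simp
    have "56 * (c * a) \<le> 1" using caa a by linarith
    then have "56 * (c * a) * (a\<^sup>2 * s) \<le> 1 * (a\<^sup>2 * s)"
      using s0 by (intro mult_right_mono)
    with s1 have h: "56 * (c * a) * (a\<^sup>2 * s) \<le> T * (a\<^sup>2 * s)" by linarith
    have i: "(1 + a / 2) * (T * (a\<^sup>2 * s)) \<le> 2 * (T * (a\<^sup>2 * s))"
      using a s0 T by (intro mult_right_mono) auto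
    have "0 \<le> T * (a\<^sup>2 * s)" using s0 T by simp
    then show ?thesis
      using bQ \<open>0 \<le> b * \<mu> * T * Q\<close> e f g \<open>0 \<le> a * a0\<close> h i kS
      by (simp add: algebra_simps add_divide_distrib diff_divide_distrib)
  qed
  finally show ?thesis .
qed

subsection \<open>Square integrability and stochastic gradients\<close>

text \<open>The Bochner integral of a non-integrable function is 0, so comparing expectations
  requires integrability of both sides; membership of the iterates in this L2 class supplies
  it.\<close>

definition sq_integrable :: "'w measure \<Rightarrow> ('w \<Rightarrow> 'v::real_normed_vector) \<Rightarrow> bool" where
  "sq_integrable M X \<longleftrightarrow> X \<in> borel_measurable M \<and> integrable M (\<lambda>\<omega>. (norm (X \<omega>))\<^sup>2)"

lemma sq_integrable_bound:
  fixes X :: "'w \<Rightarrow> 'v::euclidean_space" and Y :: "'w \<Rightarrow> 'u::euclidean_space"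
  assumes X: "X \<in> borel_measurable M" and Y: "sq_integrable M Y"
    and le: "\<And>\<omega>. \<omega> \<in> space M \<Longrightarrow> norm (X \<omega>) \<le> c * norm (Y \<omega>)"
  shows "sq_integrable M X"
  unfolding sq_integrable_def
proof
  have "integrable M (\<lambda>\<omega>. c\<^sup>2 * (norm (Y \<omega>))\<^sup>2)" using Y by (simp add: sq_integrable_def)
  then show "integrable M (\<lambda>\<omega>. (norm (X \<omega>))\<^sup>2)"
  proof (rule Bochner_Integration.integrable_bound)
    show "AE \<omega> in M. norm ((norm (X \<omega>))\<^sup>2) \<le> norm (c\<^sup>2 * (norm (Y \<omega>))\<^sup>2)"
      using power_mono[OF le, of _ 2] by (intro AE_I2) (simp add: power_mult_distrib)
  qed (use X in measurable)
qed (rule X)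

lemma sq_integrable_add:
  fixes X Y :: "'w \<Rightarrow> 'v::euclidean_space"
  assumes "sq_integrable M X" "sq_integrable M Y"
  shows "sq_integrable M (\<lambda>\<omega>. X \<omega> + Y \<omega>)"
  unfolding sq_integrable_def
proof
  have [measurable]: "X \<in> borel_measurable M" "Y \<in> borel_measurable M"
    using assms by (simp_all add: sq_integrable_def)
  show "(\<lambda>\<omega>. X \<omega> + Y \<omega>) \<in> borel_measurable M" by measurable
  have "integrable M (\<lambda>\<omega>. 2 * (norm (X \<omega>))\<^sup>2 + 2 * (norm (Y \<omega>))\<^sup>2)"
    using assms by (simp add: sq_integrable_def)
  then show "integrable M (\<lambda>\<omega>. (norm (X \<omega> + Y \<omega>))\<^sup>2)"
  proof (rule Bochner_Integration.integrable_bound)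
    show "AE \<omega> in M. norm ((norm (X \<omega> + Y \<omega>))\<^sup>2) \<le> norm (2 * (norm (X \<omega>))\<^sup>2 + 2 * (norm (Y \<omega>))\<^sup>2)"
      using norm_add_sq_le[of 1 "X _" "Y _"] by (intro AE_I2) simp
  qed measurable
qed

lemma sq_integrable_scaleR:
  fixes X :: "'w \<Rightarrow> 'v::euclidean_space"
  assumes "sq_integrable M X"
  shows "sq_integrable M (\<lambda>\<omega>. c *\<^sub>R X \<omega>)"
proof -
  have [measurable]: "X \<in> borel_measurable M" using assms by (simp add: sq_integrable_def)
  show ?thesis by (rule sq_integrable_bound[OF _ assms, where c = "\<bar>c\<bar>"]) simp_all
qed

lemma sq_integrable_diff:
  fixes X Y :: "'w \<Rightarrow> 'v::euclidean_space"
  assumes "sq_integrable M X" "sq_integrable M Y"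
  shows "sq_integrable M (\<lambda>\<omega>. X \<omega> - Y \<omega>)"
  using sq_integrable_add[OF assms(1) sq_integrable_scaleR[OF assms(2), of "-1"]] by simp

lemma sq_integrable_cong:
  fixes X Y :: "'w \<Rightarrow> 'v::real_normed_vector"
  assumes "\<And>\<omega>. \<omega> \<in> space M \<Longrightarrow> X \<omega> = Y \<omega>"
  shows "sq_integrable M X \<longleftrightarrow> sq_integrable M Y"
  unfolding sq_integrable_def using assms
  by (auto cong: measurable_cong Bochner_Integration.integrable_cong)

lemma (in finite_measure) sq_integrable_const: "sq_integrable M (\<lambda>_. c)"
  by (simp add: sq_integrable_def)

lemma sq_integrable_inner:
  fixes X Y :: "'w \<Rightarrow> 'v::euclidean_space"
  assumes "sq_integrable M X" "sq_integrable M Y"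
  shows "integrable M (\<lambda>\<omega>. inner (X \<omega>) (Y \<omega>))"
proof -
  have [measurable]: "X \<in> borel_measurable M" "Y \<in> borel_measurable M"
    using assms by (simp_all add: sq_integrable_def)
  have "integrable M (\<lambda>\<omega>. (norm (X \<omega>))\<^sup>2 + (norm (Y \<omega>))\<^sup>2)"
    using assms by (simp add: sq_integrable_def)
  then show ?thesis
  proof (rule Bochner_Integration.integrable_bound)
    have "\<bar>inner a b\<bar> \<le> (norm a)\<^sup>2 + (norm b)\<^sup>2" for a b :: 'v
    proof -
      have "0 \<le> (norm a - norm b)\<^sup>2" by simp
      then have "2 * (norm a * norm b) \<le> (norm a)\<^sup>2 + (norm b)\<^sup>2"
        by (simp add: power2_eq_square algebra_simps)
      moreover have "0 \<le> norm a * norm b" by simp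
      ultimately show ?thesis using Cauchy_Schwarz_ineq2[of a b] by linarith
    qed
    then show "AE \<omega> in M. norm (inner (X \<omega>) (Y \<omega>)) \<le> norm ((norm (X \<omega>))\<^sup>2 + (norm (Y \<omega>))\<^sup>2)"
      by (intro AE_I2) simp
  qed measurable
qed

lemma sq_integrable_component:
  fixes X :: "'w \<Rightarrow> 'v::euclidean_space"
  assumes "sq_integrable M X"
  shows "sq_integrable M (\<lambda>\<omega>. inner (X \<omega>) c)"
proof -
  have [measurable]: "X \<in> borel_measurable M" using assms by (simp add: sq_integrable_def)
  show ?thesis
    by (rule sq_integrable_bound[OF _ assms, where c = "norm c"])
      (simp_all add: Cauchy_Schwarz_ineq2 mult.commute[of "norm c"])
qed

lemma inner_vec_cond_exp:
  assumes "c \<in> Basis"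
  shows "inner (vec_cond_exp M P Z \<omega>) c = real_cond_exp M P (\<lambda>w. inner (Z w) c) \<omega>"
  using assms by (simp add: vec_cond_exp_def inner_sum_left inner_Basis if_distrib sum.delta cong: if_cong)

context prob_space
begin

context
  fixes P :: "'a measure" and g :: "'v::euclidean_space \<Rightarrow> 's \<Rightarrow> 'v" and dq :: "'v \<Rightarrow> 'v"
    and \<Delta> :: "'a \<Rightarrow> 's" and \<sigma> :: real and X :: "'a \<Rightarrow> 'v"
  assumes sub: "subalgebra M P"
    and gradient: "gradient_oracle M P g dq \<Delta> \<sigma>"
    and X: "X \<in> borel_measurable P"
    and sample: "(\<lambda>\<omega>. g (X \<omega>) (\<Delta> \<omega>)) \<in> borel_measurable M"
    and dqX: "sq_integrable M (\<lambda>\<omega>. dq (X \<omega>))"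
begin

text \<open>The second moment is given through a nonnegative conditional expectation, which
  presupposes no integrability. Integrated against the constant 1 it yields a finite integral, and
  square integrability of the noise follows.\<close>

lemma oracle_noise_sq:
  shows "sq_integrable M (\<lambda>\<omega>. g (X \<omega>) (\<Delta> \<omega>) - dq (X \<omega>))"
    and "(\<integral>\<omega>. (norm (g (X \<omega>) (\<Delta> \<omega>) - dq (X \<omega>)))\<^sup>2 \<partial>M) \<le> \<sigma>\<^sup>2"
proof -
  interpret S: finite_measure_subalgebra M P by unfold_locales (rule sub)
  let ?\<xi> = "\<lambda>\<omega>. g (X \<omega>) (\<Delta> \<omega>) - dq (X \<omega>)"
  have [measurable]: "(\<lambda>\<omega>. g (X \<omega>) (\<Delta> \<omega>)) \<in> borel_measurable M"
    "(\<lambda>\<omega>. dq (X \<omega>)) \<in> borel_measurable M"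
    using sample dqX by (simp_all add: sq_integrable_def)
  have "(\<integral>\<^sup>+\<omega>. ennreal ((norm (?\<xi> \<omega>))\<^sup>2) \<partial>M)
      = (\<integral>\<^sup>+\<omega>. 1 * nn_cond_exp M P (\<lambda>\<omega>. ennreal ((norm (?\<xi> \<omega>))\<^sup>2)) \<omega> \<partial>M)"
    by (subst S.nn_cond_exp_intg) simp_all
  also have "\<dots> \<le> (\<integral>\<^sup>+\<omega>. ennreal (\<sigma>\<^sup>2) \<partial>M)"
    using gradient X unfolding gradient_oracle_def by (intro nn_integral_mono_AE) auto
  also have "\<dots> = ennreal (\<sigma>\<^sup>2)" by (simp add: emeasure_space_1)
  finally have le: "(\<integral>\<^sup>+\<omega>. ennreal ((norm (?\<xi> \<omega>))\<^sup>2) \<partial>M) \<le> ennreal (\<sigma>\<^sup>2)" .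
  have int: "integrable M (\<lambda>\<omega>. (norm (?\<xi> \<omega>))\<^sup>2)"
    using le by (intro integrableI_bounded) (auto simp: le_less_trans)
  then show "sq_integrable M ?\<xi>" by (simp add: sq_integrable_def)
  have "ennreal (\<integral>\<omega>. (norm (?\<xi> \<omega>))\<^sup>2 \<partial>M) \<le> ennreal (\<sigma>\<^sup>2)"
    using le by (simp add: nn_integral_eq_integral[OF int])
  then show "(\<integral>\<omega>. (norm (?\<xi> \<omega>))\<^sup>2 \<partial>M) \<le> \<sigma>\<^sup>2" by (simp add: ennreal_le_iff)
qed

text \<open>The conditional expectation of a vector is componentwise, so each component of
  \<open>U\<close>, known in the past, is pulled out separately. Square integrability of both
  factors makes the products integrable, as pulling out requires.\<close>

lemma oracle_noise_orthogonal:
  assumes UP: "U \<in> borel_measurable P" and U: "sq_integrable M U"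
  shows "(\<integral>\<omega>. inner (U \<omega>) (g (X \<omega>) (\<Delta> \<omega>) - dq (X \<omega>)) \<partial>M) = 0"
proof -
  interpret S: finite_measure_subalgebra M P by unfold_locales (rule sub)
  let ?G = "\<lambda>\<omega>. g (X \<omega>) (\<Delta> \<omega>)"
  have G: "sq_integrable M ?G"
    using sq_integrable_add[OF oracle_noise_sq(1) dqX] by simp
  have component: "(\<integral>\<omega>. inner (U \<omega>) c * inner (?G \<omega>) c \<partial>M) = (\<integral>\<omega>. inner (U \<omega>) c * inner (dq (X \<omega>)) c \<partial>M)"
    if "c \<in> Basis" for c
  proof -
    have int: "integrable M (\<lambda>\<omega>. inner (U \<omega>) c * inner (?G \<omega>) c)"
      using sq_integrable_inner[OF sq_integrable_component[OF U, of c] sq_integrable_component[OF G, of c]]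
      by simp
    have [measurable]: "(\<lambda>\<omega>. inner (U \<omega>) c) \<in> borel_measurable P" using UP by measurable
    have [measurable]: "(\<lambda>\<omega>. inner (?G \<omega>) c) \<in> borel_measurable M" using sample by measurable
    have [measurable]: "(\<lambda>\<omega>. inner (U \<omega>) c) \<in> borel_measurable M"
      "(\<lambda>\<omega>. inner (dq (X \<omega>)) c) \<in> borel_measurable M"
      using sq_integrable_component[OF U] sq_integrable_component[OF dqX]
      by (simp_all add: sq_integrable_def)
    have "(\<integral>\<omega>. inner (U \<omega>) c * inner (?G \<omega>) c \<partial>M)
        = (\<integral>\<omega>. inner (U \<omega>) c * real_cond_exp M P (\<lambda>\<omega>. inner (?G \<omega>) c) \<omega> \<partial>M)"
      by (rule S.real_cond_exp_intg(2)[symmetric, OF int]) measurable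
    also have "\<dots> = (\<integral>\<omega>. inner (U \<omega>) c * inner (dq (X \<omega>)) c \<partial>M)"
    proof (rule integral_cong_AE)
      have "AE \<omega> in M. vec_cond_exp M P ?G \<omega> = dq (X \<omega>)"
        using gradient X by (simp add: gradient_oracle_def)
      then show "AE \<omega> in M. inner (U \<omega>) c * real_cond_exp M P (\<lambda>\<omega>. inner (?G \<omega>) c) \<omega>
          = inner (U \<omega>) c * inner (dq (X \<omega>)) c"
        by eventually_elim (simp flip: inner_vec_cond_exp[OF that])
    qed measurable
    finally show ?thesis .
  qed
  have int: "integrable M (\<lambda>\<omega>. inner (U \<omega>) c * inner (?G \<omega>) c)"
    "integrable M (\<lambda>\<omega>. inner (U \<omega>) c * inner (dq (X \<omega>)) c)" for c
    using sq_integrable_inner[OF sq_integrable_component[OF U, of c] sq_integrable_component[OF G, of c]]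
      sq_integrable_inner[OF sq_integrable_component[OF U, of c] sq_integrable_component[OF dqX, of c]]
    by simp_all
  have "(\<integral>\<omega>. inner (U \<omega>) (?G \<omega> - dq (X \<omega>)) \<partial>M)
      = (\<integral>\<omega>. inner (U \<omega>) (?G \<omega>) \<partial>M) - (\<integral>\<omega>. inner (U \<omega>) (dq (X \<omega>)) \<partial>M)"
    unfolding inner_diff_right
    by (intro Bochner_Integration.integral_diff sq_integrable_inner U G dqX)
  also have "\<dots> = 0"
  proof -
    have "(\<integral>\<omega>. inner (U \<omega>) (Y \<omega>) \<partial>M) = (\<integral>\<omega>. (\<Sum>c\<in>Basis. inner (U \<omega>) c * inner (Y \<omega>) c) \<partial>M)" for Y
      by (intro Bochner_Integration.integral_cong euclidean_inner refl)
    then show ?thesis by (simp add: Bochner_Integration.integral_sum int component)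
  qed
  finally show ?thesis .
qed

text \<open>Orthogonality removes the cross term, so the noise enters with \<open>a^2\<close>; the
  triangle inequality would leave a term of first order in \<open>a\<close>.\<close>

lemma oracle_step_sq:
  assumes UP: "U \<in> borel_measurable P" and U: "sq_integrable M U"
  shows "(\<integral>\<omega>. (norm (U \<omega> + a *\<^sub>R (g (X \<omega>) (\<Delta> \<omega>) - dq (X \<omega>))))\<^sup>2 \<partial>M)
    \<le> (\<integral>\<omega>. (norm (U \<omega>))\<^sup>2 \<partial>M) + a\<^sup>2 * \<sigma>\<^sup>2"
proof -
  let ?\<xi> = "\<lambda>\<omega>. g (X \<omega>) (\<Delta> \<omega>) - dq (X \<omega>)"
  have "(norm (U \<omega> + a *\<^sub>R ?\<xi> \<omega>))\<^sup>2 = (norm (U \<omega>))\<^sup>2 + 2 * a * inner (U \<omega>) (?\<xi> \<omega>) + a\<^sup>2 * (norm (?\<xi> \<omega>))\<^sup>2" for \<omega>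
    unfolding power2_norm_eq_inner
    by (simp add: inner_add_left inner_add_right inner_commute power2_eq_square)
  then have "(\<integral>\<omega>. (norm (U \<omega> + a *\<^sub>R ?\<xi> \<omega>))\<^sup>2 \<partial>M)
      = (\<integral>\<omega>. (norm (U \<omega>))\<^sup>2 + 2 * a * inner (U \<omega>) (?\<xi> \<omega>) + a\<^sup>2 * (norm (?\<xi> \<omega>))\<^sup>2 \<partial>M)"
    by simp
  also have "\<dots> = (\<integral>\<omega>. (norm (U \<omega>))\<^sup>2 \<partial>M) + 2 * a * (\<integral>\<omega>. inner (U \<omega>) (?\<xi> \<omega>) \<partial>M)
      + a\<^sup>2 * (\<integral>\<omega>. (norm (?\<xi> \<omega>))\<^sup>2 \<partial>M)"
    using U oracle_noise_sq(1) sq_integrable_inner[OF U oracle_noise_sq(1)]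
    by (simp add: sq_integrable_def)
  finally show ?thesis
    using oracle_noise_sq(2) by (simp add: oracle_noise_orthogonal[OF UP U] mult_left_mono)
qed

end

end

text \<open>The two sides differ by \<open>(1 - a) * a\<close> times the squared distance of
  \<open>u\<close> and \<open>v\<close>. The weight of \<open>v\<close> stays \<open>a\<close>, so
  the drift will enter the tracking error with a factor \<open>\<alpha> k\<close>.\<close>

lemma norm_convex_sq_le:
  fixes u v :: "'v::real_inner"
  assumes "0 \<le> a" "a \<le> 1"
  shows "(norm ((1 - a) *\<^sub>R u + a *\<^sub>R v))\<^sup>2 \<le> (1 - a) * (norm u)\<^sup>2 + a * (norm v)\<^sup>2"
proof -
  have "0 \<le> (1 - a) * a * (norm (u - v))\<^sup>2" using assms by simp
  also have "\<dots> = (1 - a) * (norm u)\<^sup>2 + a * (norm v)\<^sup>2 - (norm ((1 - a) *\<^sub>R u + a *\<^sub>R v))\<^sup>2"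
    unfolding power2_norm_eq_inner
    by (simp add: inner_add_left inner_add_right inner_diff_left inner_diff_right inner_commute algebra_simps)
  finally show ?thesis by simp
qed

text \<open>One factor \<open>1 - a\<close> is kept and the later ones are bounded by 1: a single
  contraction per round is enough to outweigh the rate \<open>\<mu> * T * b\<close>. At
  \<open>t = 0\<close> no contraction has happened yet, hence the two forms.\<close>

lemma contraction_iterate_le:
  fixes u :: "nat \<Rightarrow> real"
  assumes step: "\<And>t. t < T \<Longrightarrow> u (Suc t) \<le> (1 - a) * u t + c"
    and a: "0 \<le> a" "a \<le> 1" and c: "0 \<le> c" and u: "0 \<le> u 0"
  shows "t \<le> T \<Longrightarrow> u t \<le> u 0 + real t * c"
    and "1 \<le> t \<Longrightarrow> t \<le> T \<Longrightarrow> u t \<le> (1 - a) * u 0 + real t * c"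
proof -
  have *: "u (Suc t) \<le> (1 - a) * u 0 + real (Suc t) * c" if "t < T" for t
    using that
  proof (induction t)
    case 0 then show ?case using step[of 0] by simp
  next
    case (Suc t)
    have "u (Suc (Suc t)) \<le> (1 - a) * u (Suc t) + c" by (rule step[OF Suc.prems])
    also have "\<dots> \<le> (1 - a) * ((1 - a) * u 0 + real (Suc t) * c) + c"
      using Suc a by (intro add_right_mono mult_left_mono) auto
    also have "\<dots> \<le> 1 * ((1 - a) * u 0 + real (Suc t) * c) + c"
      using a c u by (intro add_right_mono mult_right_mono) auto
    finally show ?case by (simp add: algebra_simps)
  qed
  show 1: "1 \<le> t \<Longrightarrow> t \<le> T \<Longrightarrow> u t \<le> (1 - a) * u 0 + real t * c"
    using *[of "t - 1"] by (cases t) auto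
  have "(1 - a) * u 0 \<le> 1 * u 0" using a u by (intro mult_right_mono) auto
  then show "t \<le> T \<Longrightarrow> u t \<le> u 0 + real t * c"
    using 1 by (cases t) auto
qed

subsection \<open>Measurability and integrability of the iterates\<close>

text \<open>Byzantine messages are only required to be random variables; neither integrability nor
  any relation to the samples is asked of them.\<close>

locale byzantine_sgd = honest_objectives H q L xs + prob_space M
  for H :: "nat set" and q :: "nat \<Rightarrow> 'v::euclidean_space \<Rightarrow> real" and L :: real and xs :: 'v
    and M :: "'w measure" +
  fixes D :: "'s measure" and N f T :: nat and g :: "nat \<Rightarrow> 'v \<Rightarrow> 's \<Rightarrow> 'v"
    and \<Delta> :: "nat \<Rightarrow> nat \<Rightarrow> nat \<Rightarrow> 'w \<Rightarrow> 's" and x0 :: 'v and y0 :: "nat \<Rightarrow> 'v"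
    and xbar :: "nat \<Rightarrow> 'w \<Rightarrow> 'v" and x y :: "nat \<Rightarrow> nat \<Rightarrow> nat \<Rightarrow> 'w \<Rightarrow> 'v"
    and F :: "nat \<Rightarrow> 'w \<Rightarrow> nat set" and \<alpha> \<beta> :: "nat \<Rightarrow> real" and \<sigma> :: real
  assumes agents: "H \<subseteq> {..<N}" "card H = N - f"
    and T: "T \<ge> 1"
    and oracle_measurable: "\<And>i. i \<in> H \<Longrightarrow> (\<lambda>(z, s). g i z s) \<in> borel_measurable (borel \<Otimes>\<^sub>M D)"
    and sample_measurable: "\<And>i k t. i \<in> H \<Longrightarrow> t < T \<Longrightarrow> \<Delta> i k t \<in> measurable M D"
    and byzantine_measurable: "\<And>i k. i \<in> {..<N} - H \<Longrightarrow> x i k T \<in> borel_measurable M"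
    and selection_measurable [measurable]: "\<And>k. F k \<in> measurable M (count_space UNIV)"
    and algorithm: "\<And>\<omega>. \<omega> \<in> space M \<Longrightarrow>
      algorithm_path N f H T \<alpha> \<beta> g x0 y0 (\<lambda>i k t. \<Delta> i k t \<omega>)
        (\<lambda>k. xbar k \<omega>) (\<lambda>i k t. x i k t \<omega>) (\<lambda>i k t. y i k t \<omega>) (\<lambda>k. F k \<omega>)"
    and noise: "\<And>i k t. \<lbrakk>i \<in> H; t < T\<rbrakk> \<Longrightarrow>
      gradient_oracle M (history M D N H T \<Delta> xbar x y F k t) (g i) (grad (q i)) (\<Delta> i k t) \<sigma>"
    and \<alpha>: "\<And>k. 0 < \<alpha> k" "\<And>k. \<alpha> k \<le> 1"
    and \<beta>: "\<And>k. 0 < \<beta> k"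
begin

lemma
  assumes "\<omega> \<in> space M"
  shows xbar_0: "xbar 0 \<omega> = x0"
    and xbar_mean: "xbar (Suc k) \<omega> = (1 / real (card (F k \<omega>))) *\<^sub>R (\<Sum>i\<in>F k \<omega>. x i k T \<omega>)"
    and elimination: "comparative_elimination N f (\<lambda>i. norm (xbar k \<omega> - x i k T \<omega>)) (F k \<omega>)"
  using algorithm[OF assms] by (simp_all add: algorithm_path_def)

lemma
  assumes "\<omega> \<in> space M" "i \<in> H"
  shows y_00: "y i 0 0 \<omega> = y0 i"
    and x_start: "x i k 0 \<omega> = xbar k \<omega>"
    and y_start: "y i (Suc k) 0 \<omega> = y i k T \<omega>"
    and x_Suc: "t < T \<Longrightarrow> x i k (Suc t) \<omega> = x i k t \<omega> - \<beta> k *\<^sub>R y i k t \<omega>"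
    and y_Suc: "t < T \<Longrightarrow> y i k (Suc t) \<omega>
      = (1 - \<alpha> k) *\<^sub>R y i k t \<omega> + \<alpha> k *\<^sub>R g i (x i k t \<omega>) (\<Delta> i k t \<omega>)"
  using algorithm[OF assms(1)] assms(2) by (simp_all add: algorithm_path_def)

lemma
  assumes "\<omega> \<in> space M"
  shows F_subset: "F k \<omega> \<subseteq> {..<N}" and F_finite: "finite (F k \<omega>)"
    and card_F: "card (F k \<omega>) = card H"
  using comparative_elimination_facts(1,2)[OF elimination[OF assms, of k]] agents
  by (auto intro: finite_subset)

lemma x_eq:
  assumes "\<omega> \<in> space M" "i \<in> H"
  shows "t \<le> T \<Longrightarrow> x i k t \<omega> = xbar k \<omega> - \<beta> k *\<^sub>R (\<Sum>s<t. y i k s \<omega>)"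
  by (induction t) (simp_all add: x_start[OF assms] x_Suc[OF assms] algebra_simps)

text \<open>The bridge from the random algorithm to the deterministic locale. Displacements from
  \<open>xbar k\<close> may replace messages because \<open>F k\<close> has exactly
  \<open>card H\<close> members, so the mean message is \<open>xbar k\<close> plus the mean
  displacement.\<close>

lemma server_round:
  assumes \<omega>: "\<omega> \<in> space M"
  shows "aggregation_round H q L xs T (\<beta> k) (\<lambda>i t. y i k t \<omega>) (\<lambda>i. x i k T \<omega> - xbar k \<omega>)
    (xbar k \<omega>) (xbar (Suc k) \<omega>) (F k \<omega>)"
proof (intro aggregation_round.intro honest_objectives_axioms aggregation_round_axioms.intro)
  show "x i k T \<omega> - xbar k \<omega> = - \<beta> k *\<^sub>R (\<Sum>t<T. y i k t \<omega>)" if "i \<in> H" for i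
    using x_eq[OF \<omega> that, of T k] by simp
  show "norm (x i k T \<omega> - xbar k \<omega>) \<le> norm (x j k T \<omega> - xbar k \<omega>)"
    if "i \<in> F k \<omega> - H" "j \<in> H - F k \<omega>" for i j
    using comparative_elimination_facts(3)[OF elimination[OF \<omega>, of k], of i j] that agents
    by (auto simp: norm_minus_commute)
  have "(\<Sum>i\<in>F k \<omega>. x i k T \<omega> - xbar k \<omega>) = (\<Sum>i\<in>F k \<omega>. x i k T \<omega>) - real (card H) *\<^sub>R xbar k \<omega>"
    by (simp add: sum_subtractf card_F[OF \<omega>] sum_constant_scaleR)
  then show "xbar (Suc k) \<omega> = xbar k \<omega> + (1 / real (card H)) *\<^sub>R (\<Sum>i\<in>F k \<omega>. x i k T \<omega> - xbar k \<omega>)"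
    using card_pos by (simp add: xbar_mean[OF \<omega>] card_F[OF \<omega>] scaleR_diff_right)
qed (use \<beta> F_finite[OF \<omega>] card_F[OF \<omega>] in auto)

lemma grad_continuous: "i \<in> H \<Longrightarrow> continuous_on UNIV (grad (q i))"
proof (rule lipschitz_on_continuous_on[where L = L])
  assume "i \<in> H"
  then show "L-lipschitz_on UNIV (grad (q i))"
    using smooth[of i] L by (intro lipschitz_onI) (auto simp: dist_norm)
qed

lemma grad_measurable [measurable]: "i \<in> H \<Longrightarrow> grad (q i) \<in> borel_measurable borel"
  by (rule borel_measurable_continuous_onI[OF grad_continuous])

lemma gap_measurable [measurable]: "gap \<in> borel_measurable borel"
proof -
  have "continuous_on UNIV (avg_obj H q)"
    using avg_differentiable by (intro differentiable_imp_continuous_on)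
      (simp add: differentiable_on_def)
  then show ?thesis unfolding gap_def
    by (intro borel_measurable_continuous_onI continuous_intros)
qed

lemma local_step_measurable:
  assumes [measurable]: "xbar k \<in> borel_measurable M" and i: "i \<in> H"
    and y: "y i k 0 \<in> borel_measurable M"
  shows "t \<le> T \<Longrightarrow> x i k t \<in> borel_measurable M \<and> y i k t \<in> borel_measurable M"
proof (induction t)
  case 0
  have "x i k 0 \<in> borel_measurable M \<longleftrightarrow> xbar k \<in> borel_measurable M"
    by (rule measurable_cong) (simp add: x_start i)
  then show ?case using y by simp
next
  case (Suc t)
  then have t: "t < T" and [measurable]: "x i k t \<in> borel_measurable M" "y i k t \<in> borel_measurable M"
    by auto
  have [measurable]: "\<Delta> i k t \<in> measurable M D" using sample_measurable i t by auto
  have [measurable]: "(\<lambda>\<omega>. g i (x i k t \<omega>) (\<Delta> i k t \<omega>)) \<in> borel_measurable M"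
    using measurable_compose[OF _ oracle_measurable[OF i], of "\<lambda>\<omega>. (x i k t \<omega>, \<Delta> i k t \<omega>)" M] by simp
  have "x i k (Suc t) \<in> borel_measurable M \<longleftrightarrow>
      (\<lambda>\<omega>. x i k t \<omega> - \<beta> k *\<^sub>R y i k t \<omega>) \<in> borel_measurable M"
    by (rule measurable_cong) (simp add: x_Suc i t)
  moreover have "y i k (Suc t) \<in> borel_measurable M \<longleftrightarrow>
      (\<lambda>\<omega>. (1 - \<alpha> k) *\<^sub>R y i k t \<omega> + \<alpha> k *\<^sub>R g i (x i k t \<omega>) (\<Delta> i k t \<omega>)) \<in> borel_measurable M"
    by (rule measurable_cong) (simp add: y_Suc i t)
  ultimately show ?case by simp
qed

text \<open>The index set of the mean is random. A sum over all agents with the indicator of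
  \<open>i \<in> F k\<close> has a fixed index set, and each indicator is measurable.\<close>

lemma server_step_measurable:
  assumes "\<And>i. i \<in> H \<Longrightarrow> x i k T \<in> borel_measurable M"
  shows "xbar (Suc k) \<in> borel_measurable M"
proof -
  have x: "x i k T \<in> borel_measurable M" if "i < N" for i
    using that assms byzantine_measurable by (cases "i \<in> H") auto
  have [measurable]: "Measurable.pred M (\<lambda>\<omega>. i \<in> F k \<omega>)" for i
    by (rule measurable_compose[OF selection_measurable]) simp
  have "xbar (Suc k) \<in> borel_measurable M \<longleftrightarrow>
      (\<lambda>\<omega>. (1 / real (card H)) *\<^sub>R (\<Sum>i<N. if i \<in> F k \<omega> then x i k T \<omega> else 0)) \<in> borel_measurable M"
  proof (rule measurable_cong)
    fix \<omega> assume \<omega>: "\<omega> \<in> space M"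
    have "{..<N} \<inter> F k \<omega> = F k \<omega>" using F_subset[OF \<omega>] by blast
    then show "xbar (Suc k) \<omega> = (1 / real (card H)) *\<^sub>R (\<Sum>i<N. if i \<in> F k \<omega> then x i k T \<omega> else 0)"
      by (simp add: xbar_mean[OF \<omega>] card_F[OF \<omega>] flip: sum.inter_restrict)
  qed
  also have "\<dots>"
    by (intro borel_measurable_scaleR borel_measurable_const borel_measurable_sum measurable_If x) auto
  finally show ?thesis .
qed

lemma iterates_measurable:
  "xbar k \<in> borel_measurable M \<and> (\<forall>i\<in>H. y i k 0 \<in> borel_measurable M)"
proof (induction k)
  case 0
  have "xbar 0 \<in> borel_measurable M \<longleftrightarrow> (\<lambda>_. x0) \<in> borel_measurable M"
    by (rule measurable_cong) (simp add: xbar_0)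
  moreover have "y i 0 0 \<in> borel_measurable M \<longleftrightarrow> (\<lambda>_. y0 i) \<in> borel_measurable M" if "i \<in> H" for i
    by (rule measurable_cong) (simp add: y_00 that)
  ultimately show ?case by simp
next
  case (Suc k)
  have xy: "x i k T \<in> borel_measurable M \<and> y i k T \<in> borel_measurable M" if "i \<in> H" for i
    using local_step_measurable[of k i T] Suc that by simp
  have "y i (Suc k) 0 \<in> borel_measurable M \<longleftrightarrow> y i k T \<in> borel_measurable M" if "i \<in> H" for i
    by (rule measurable_cong) (simp add: y_start that)
  then show ?case using xy server_step_measurable by blast
qed

lemma xbar_measurable [measurable]: "xbar k \<in> borel_measurable M"
  using iterates_measurable by blast

lemma
  assumes "i \<in> H" "t \<le> T"
  shows x_measurable: "x i k t \<in> borel_measurable M" and y_measurable: "y i k t \<in> borel_measurable M"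
  using local_step_measurable[OF xbar_measurable assms(1) _ assms(2)] iterates_measurable assms(1) by blast+

abbreviation past :: "nat \<Rightarrow> nat \<Rightarrow> 'w measure" where
  "past k t \<equiv> history M D N H T \<Delta> xbar x y F k t"

text \<open>The noise assumptions are relative to \<open>history\<close>, so it must be a
  sub-sigma-algebra that knows the current iterates. The bound \<open>t < T\<close> keeps all
  generators in the index range where measurability has been established.\<close>

lemma
  assumes "t < T"
  shows past_subalgebra: "subalgebra M (past k t)"
    and xbar_past: "xbar k \<in> borel_measurable (past k t)"
    and x_past: "i \<in> H \<Longrightarrow> x i k t \<in> borel_measurable (past k t)"
    and y_past: "i \<in> H \<Longrightarrow> y i k t \<in> borel_measurable (past k t)"
proof -
  define A where "A = {xbar l -` A \<inter> space M | l A. l \<le> k \<and> A \<in> sets borel} \<union>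
     {x i l s -` A \<inter> space M | i l s A.
        i \<in> H \<and> (l < k \<and> s \<le> T \<or> l = k \<and> s \<le> t) \<and> A \<in> sets borel} \<union>
     {y i l s -` A \<inter> space M | i l s A.
        i \<in> H \<and> (l < k \<and> s \<le> T \<or> l = k \<and> s \<le> t) \<and> A \<in> sets borel} \<union>
     {\<Delta> i l s -` A \<inter> space M | i l s A.
        i \<in> H \<and> (l < k \<and> s < T \<or> l = k \<and> s < t) \<and> A \<in> sets D} \<union>
     {x i l T -` A \<inter> space M | i l A. i \<in> {..<N} - H \<and> l < k \<and> A \<in> sets borel} \<union>
     {F l -` A \<inter> space M | l A. l < k}"
  have past: "past k t = sigma (space M) A" by (simp add: history_def A_def)
  have xbar': "xbar l -` B \<inter> space M \<in> sets M" if "B \<in> sets borel" for l B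
    using measurable_sets[OF xbar_measurable that] .
  have x': "x i l s -` B \<inter> space M \<in> sets M" and y': "y i l s -` B \<inter> space M \<in> sets M"
    if "i \<in> H" "s \<le> T" "B \<in> sets borel" for i l s B
    using measurable_sets[OF x_measurable that(3)] measurable_sets[OF y_measurable that(3)] that by blast+
  have \<Delta>': "\<Delta> i l s -` B \<inter> space M \<in> sets M" if "i \<in> H" "s < T" "B \<in> sets D" for i l s B
    using measurable_sets[OF sample_measurable that(3)] that by blast
  have byz': "x i l T -` B \<inter> space M \<in> sets M" if "i \<in> {..<N} - H" "B \<in> sets borel" for i l B
    using measurable_sets[OF byzantine_measurable that(2)] that by blast
  have F': "F l -` B \<inter> space M \<in> sets M" for l B
    using measurable_sets[OF selection_measurable] by simp
  have A_M: "A \<subseteq> sets M"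
    unfolding A_def using assms
    by (intro Un_least) (auto intro: xbar' x' y' \<Delta>' byz' F')
  then have pow: "A \<subseteq> Pow (space M)" using sets.space_closed by blast
  have past_sets: "sets (past k t) = sigma_sets (space M) A" and past_space: "space (past k t) = space M"
    using pow by (simp_all add: past)
  show "subalgebra M (past k t)"
    unfolding subalgebra_def past_sets past_space
    using A_M by (simp add: sets.sigma_sets_subset)
  \<comment> \<open>A function whose preimages are themselves generators is measurable; the chains
    of union rules below merely select the right block of generators.\<close>
  have meas: "X \<in> borel_measurable (past k t)"
    if "\<And>B. B \<in> sets borel \<Longrightarrow> X -` B \<inter> space M \<in> A" for X :: "'w \<Rightarrow> 'v"
  proof (rule measurableI)
    show "X -` B \<inter> space (past k t) \<in> sets (past k t)" if "B \<in> sets borel" for B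
      unfolding past_sets past_space using \<open>\<And>B. B \<in> sets borel \<Longrightarrow> X -` B \<inter> space M \<in> A\<close>[OF that]
      by (rule sigma_sets.Basic)
  qed simp
  show "xbar k \<in> borel_measurable (past k t)"
  proof (rule meas)
    fix B :: "'v set" assume "B \<in> sets borel"
    then show "xbar k -` B \<inter> space M \<in> A"
      unfolding A_def by (intro UnI1 CollectI exI[of _ k] exI[of _ B]) simp
  qed
  show "x i k t \<in> borel_measurable (past k t)" if "i \<in> H"
  proof (rule meas)
    fix B :: "'v set" assume "B \<in> sets borel"
    with that show "x i k t -` B \<inter> space M \<in> A"
      unfolding A_def
      by (intro UnI1[THEN UnI1, THEN UnI1, THEN UnI1] UnI2 CollectI exI[of _ i] exI[of _ k] exI[of _ t] exI[of _ B]) simp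
  qed
  show "y i k t \<in> borel_measurable (past k t)" if "i \<in> H"
  proof (rule meas)
    fix B :: "'v set" assume "B \<in> sets borel"
    with that show "y i k t -` B \<inter> space M \<in> A"
      unfolding A_def
      by (intro UnI1[THEN UnI1, THEN UnI1] UnI2 CollectI exI[of _ i] exI[of _ k] exI[of _ t] exI[of _ B]) simp
  qed
qed

lemma sq_integrable_grad:
  assumes X: "sq_integrable M X" and i: "i \<in> H"
  shows "sq_integrable M (\<lambda>\<omega>. grad (q i) (X \<omega>))"
proof (rule sq_integrable_bound)
  show "sq_integrable M (\<lambda>\<omega>. X \<omega> - xs)"
    by (intro sq_integrable_diff X sq_integrable_const)
  have [measurable]: "X \<in> borel_measurable M" using X by (simp add: sq_integrable_def)
  show "(\<lambda>\<omega>. grad (q i) (X \<omega>)) \<in> borel_measurable M" using i by measurable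
qed (rule norm_grad_le[OF i])

lemma sample_gradient_measurable:
  assumes "i \<in> H" "t < T"
  shows "(\<lambda>\<omega>. g i (x i k t \<omega>) (\<Delta> i k t \<omega>)) \<in> borel_measurable M"
  using measurable_compose[OF measurable_Pair[OF x_measurable sample_measurable] oracle_measurable] assms
  by simp

text \<open>The sampled gradient is the true gradient, which grows at most linearly by smoothness,
  plus noise of bounded variance; both are square integrable if \<open>x i k t\<close> is.\<close>

lemma local_step_sq_integrable:
  assumes xbar: "sq_integrable M (xbar k)" and i: "i \<in> H" and y: "sq_integrable M (y i k 0)"
  shows "t \<le> T \<Longrightarrow> sq_integrable M (x i k t) \<and> sq_integrable M (y i k t)"
proof (induction t)
  case 0
  then show ?case
    using xbar y sq_integrable_cong[of M "x i k 0" "xbar k"] by (simp add: x_start i)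
next
  case (Suc t)
  then have t: "t < T" and x_t: "sq_integrable M (x i k t)" and y_t: "sq_integrable M (y i k t)"
    by auto
  have grad_t: "sq_integrable M (\<lambda>\<omega>. grad (q i) (x i k t \<omega>))"
    by (rule sq_integrable_grad[OF x_t i])
  have "sq_integrable M (\<lambda>\<omega>. g i (x i k t \<omega>) (\<Delta> i k t \<omega>))"
    using sq_integrable_add[OF oracle_noise_sq(1)[OF past_subalgebra[OF t] noise[OF i t]
        x_past[OF t i] sample_gradient_measurable[OF i t] grad_t] grad_t] by simp
  then have "sq_integrable M (\<lambda>\<omega>. (1 - \<alpha> k) *\<^sub>R y i k t \<omega> + \<alpha> k *\<^sub>R g i (x i k t \<omega>) (\<Delta> i k t \<omega>))"
    by (intro sq_integrable_add sq_integrable_scaleR y_t)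
  moreover have "sq_integrable M (\<lambda>\<omega>. x i k t \<omega> - \<beta> k *\<^sub>R y i k t \<omega>)"
    by (intro sq_integrable_diff sq_integrable_scaleR x_t y_t)
  ultimately show ?case
    using sq_integrable_cong[of M "x i k (Suc t)"] sq_integrable_cong[of M "y i k (Suc t)"]
    by (simp add: x_Suc y_Suc i t)
qed

lemma integrable_avg:
  assumes "\<And>i. i \<in> H \<Longrightarrow> integrable M (\<phi> i)"
  shows "integrable M (\<lambda>\<omega>. avg (\<lambda>i. \<phi> i \<omega>))"
    and "(\<integral>\<omega>. avg (\<lambda>i. \<phi> i \<omega>) \<partial>M) = avg (\<lambda>i. \<integral>\<omega>. \<phi> i \<omega> \<partial>M)"
  using assms by (simp_all add: avg_def Bochner_Integration.integral_sum)

text \<open>Byzantine messages may fail to be integrable. The server point is square integrable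
  nevertheless, since elimination bounds its displacement by the honest displacements alone.\<close>

lemma iterates_sq_integrable:
  "sq_integrable M (xbar k) \<and> (\<forall>i\<in>H. sq_integrable M (y i k 0))"
proof (induction k)
  case 0
  show ?case
    using sq_integrable_cong[of M "xbar 0" "\<lambda>_. x0"] sq_integrable_cong[of M "y _ 0 0" "\<lambda>_. y0 _"]
    by (simp add: xbar_0 y_00 sq_integrable_const)
next
  case (Suc k)
  have xy: "sq_integrable M (x i k T) \<and> sq_integrable M (y i k T)" if "i \<in> H" for i
    using local_step_sq_integrable[of k i T] Suc that by simp
  have d: "integrable M (\<lambda>\<omega>. (norm (x i k T \<omega> - xbar k \<omega>))\<^sup>2)" if "i \<in> H" for i
    using sq_integrable_diff[of M "x i k T" "xbar k"] xy[OF that] Suc by (simp add: sq_integrable_def)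
  have "integrable M (\<lambda>\<omega>. (norm (xbar (Suc k) \<omega> - xbar k \<omega>))\<^sup>2)"
  proof (rule Bochner_Integration.integrable_bound)
    show "integrable M (\<lambda>\<omega>. avg (\<lambda>i. (norm (x i k T \<omega> - xbar k \<omega>))\<^sup>2))"
      by (rule integrable_avg(1)) (rule d)
    show "AE \<omega> in M. norm ((norm (xbar (Suc k) \<omega> - xbar k \<omega>))\<^sup>2)
        \<le> norm (avg (\<lambda>i. (norm (x i k T \<omega> - xbar k \<omega>))\<^sup>2))"
      using aggregation_round.server_step_sq_le_avg[OF server_round]
      by (intro AE_I2) (force intro: order_trans[OF _ abs_ge_self])
  qed measurable
  then have "sq_integrable M (\<lambda>\<omega>. xbar (Suc k) \<omega> - xbar k \<omega>)" by (simp add: sq_integrable_def)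
  then have "sq_integrable M (xbar (Suc k))"
    using sq_integrable_add[of M "\<lambda>\<omega>. xbar (Suc k) \<omega> - xbar k \<omega>" "xbar k"] Suc by simp
  moreover have "sq_integrable M (y i (Suc k) 0)" if "i \<in> H" for i
    using xy[OF that] sq_integrable_cong[of M "y i (Suc k) 0" "y i k T"] by (simp add: y_start that)
  ultimately show ?case by blast
qed

lemma xbar_sq_integrable: "sq_integrable M (xbar k)"
  using iterates_sq_integrable by blast

lemma
  assumes "i \<in> H" "t \<le> T"
  shows x_sq_integrable: "sq_integrable M (x i k t)" and y_sq_integrable: "sq_integrable M (y i k t)"
  using local_step_sq_integrable[OF xbar_sq_integrable assms(1) _ assms(2)] iterates_sq_integrable assms(1)
  by blast+

lemma track_err_sq_integrable:
  assumes "i \<in> H" "t \<le> T"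
  shows "sq_integrable M (\<lambda>\<omega>. y i k t \<omega> - grad (q i) (xbar k \<omega>))"
  by (intro sq_integrable_diff sq_integrable_grad y_sq_integrable xbar_sq_integrable assms)

text \<open>Smoothness at the stationary point \<open>xs\<close> bounds the gap by
  \<open>L / 2\<close> times a squared distance.\<close>

lemma gap_integrable: "integrable M (\<lambda>\<omega>. gap (xbar k \<omega>))"
proof (rule Bochner_Integration.integrable_bound)
  show "integrable M (\<lambda>\<omega>. L / 2 * (norm (xbar k \<omega> - xs))\<^sup>2)"
    using sq_integrable_diff[OF xbar_sq_integrable sq_integrable_const, of k xs]
    by (simp add: sq_integrable_def)
  have "grad (avg_obj H q) xs = 0"
    by (rule grad_minimizer[OF avg_differentiable avg_smooth xs_avg L])
  then have "gap z \<le> L / 2 * (norm (z - xs))\<^sup>2" for z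
    using descent_lemma[OF avg_differentiable avg_smooth, of z xs] by (simp add: gap_def)
  then show "AE \<omega> in M. norm (gap (xbar k \<omega>)) \<le> norm (L / 2 * (norm (xbar k \<omega> - xs))\<^sup>2)"
    using gap_nonneg L by (intro AE_I2) simp
qed measurable

end

subsection \<open>Expected progress of one round\<close>

context byzantine_sgd
begin

text \<open>At \<open>t = 0\<close> this is \<open>W_fun\<close>. The value at \<open>t = T\<close>
  still refers to \<open>xbar k\<close>, and differs from the value at the start of the next round
  only in the point at which the gradients are taken.\<close>

definition track :: "nat \<Rightarrow> nat \<Rightarrow> 'w \<Rightarrow> real" where
  "track k t \<omega> = avg (\<lambda>i. (norm (y i k t \<omega> - grad (q i) (xbar k \<omega>)))\<^sup>2)"

definition round_err :: "nat \<Rightarrow> 'w \<Rightarrow> real" where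
  "round_err k \<omega> = avg (\<lambda>i. \<Sum>t<T. (norm (y i k t \<omega> - grad (q i) (xbar k \<omega>)))\<^sup>2)"

text \<open>Expectation of the pathwise bound in \<open>avg_drift_le\<close>; it plays the role of
  \<open>X\<close> in \<open>round_recursion\<close>.\<close>

definition drift_bound :: "nat \<Rightarrow> real" where
  "drift_bound k = (\<beta> k)\<^sup>2 * real T *
    (2 * (\<integral>\<omega>. round_err k \<omega> \<partial>M) + 4 * L * real T * (\<integral>\<omega>. gap (xbar k \<omega>) \<partial>M))"

lemma round_err_eq: "round_err k \<omega> = (\<Sum>t<T. track k t \<omega>)"
  by (simp add: round_err_def track_def avg_sum)

lemma track_nonneg: "0 \<le> track k t \<omega>"
  unfolding track_def by (rule avg_nonneg) simp

lemma
  assumes "t \<le> T"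
  shows track_integrable: "integrable M (track k t)"
    and integral_track: "(\<integral>\<omega>. track k t \<omega> \<partial>M)
      = avg (\<lambda>i. \<integral>\<omega>. (norm (y i k t \<omega> - grad (q i) (xbar k \<omega>)))\<^sup>2 \<partial>M)"
  unfolding track_def
  using integrable_avg[of "\<lambda>i \<omega>. (norm (y i k t \<omega> - grad (q i) (xbar k \<omega>)))\<^sup>2"]
    track_err_sq_integrable[OF _ assms] by (simp_all add: sq_integrable_def)

lemma round_err_integrable: "integrable M (round_err k)"
  unfolding round_err_eq by (intro Bochner_Integration.integrable_sum track_integrable) simp

lemma integral_round_err: "(\<integral>\<omega>. round_err k \<omega> \<partial>M) = (\<Sum>t<T. \<integral>\<omega>. track k t \<omega> \<partial>M)"
  unfolding round_err_eq by (intro Bochner_Integration.integral_sum track_integrable) simp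

lemma drift_le:
  assumes t: "t \<le> T"
  shows "avg (\<lambda>i. \<integral>\<omega>. (norm (x i k t \<omega> - xbar k \<omega>))\<^sup>2 \<partial>M) \<le> drift_bound k"
proof -
  have d: "integrable M (\<lambda>\<omega>. (norm (x i k t \<omega> - xbar k \<omega>))\<^sup>2)" if "i \<in> H" for i
    using sq_integrable_diff[OF x_sq_integrable[OF that t] xbar_sq_integrable, of k k]
    by (simp add: sq_integrable_def)
  have "avg (\<lambda>i. \<integral>\<omega>. (norm (x i k t \<omega> - xbar k \<omega>))\<^sup>2 \<partial>M)
      = (\<integral>\<omega>. avg (\<lambda>i. (norm (x i k t \<omega> - xbar k \<omega>))\<^sup>2) \<partial>M)"
    by (rule integrable_avg(2)[symmetric]) (rule d)
  also have "\<dots> \<le> (\<integral>\<omega>. (\<beta> k)\<^sup>2 * real T * (2 * round_err k \<omega> + 4 * L * real T * gap (xbar k \<omega>)) \<partial>M)"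
  proof (rule integral_mono)
    show "integrable M (\<lambda>\<omega>. avg (\<lambda>i. (norm (x i k t \<omega> - xbar k \<omega>))\<^sup>2))"
      by (rule integrable_avg(1)) (rule d)
    show "integrable M (\<lambda>\<omega>. (\<beta> k)\<^sup>2 * real T * (2 * round_err k \<omega> + 4 * L * real T * gap (xbar k \<omega>)))"
      using round_err_integrable gap_integrable by simp
    fix \<omega> assume \<omega>: "\<omega> \<in> space M"
    have "avg (\<lambda>i. (norm (x i k t \<omega> - xbar k \<omega>))\<^sup>2)
        \<le> avg (\<lambda>i. (norm (\<beta> k *\<^sub>R (\<Sum>s<t. y i k s \<omega>)))\<^sup>2)"
      by (rule avg_mono) (simp add: x_eq[OF \<omega> _ t])
    also have "\<dots> \<le> (\<beta> k)\<^sup>2 * real T * (2 * round_err k \<omega> + 4 * L * real T * gap (xbar k \<omega>))"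
      unfolding round_err_def by (rule avg_drift_le[OF t])
    finally show "avg (\<lambda>i. (norm (x i k t \<omega> - xbar k \<omega>))\<^sup>2)
        \<le> (\<beta> k)\<^sup>2 * real T * (2 * round_err k \<omega> + 4 * L * real T * gap (xbar k \<omega>))" .
  qed
  also have "\<dots> = drift_bound k"
    using round_err_integrable gap_integrable by (simp add: drift_bound_def)
  finally show ?thesis .
qed

lemma agent_track_step:
  assumes t: "t < T" and i: "i \<in> H"
  shows "(\<integral>\<omega>. (norm (y i k (Suc t) \<omega> - grad (q i) (xbar k \<omega>)))\<^sup>2 \<partial>M)
    \<le> (1 - \<alpha> k) * (\<integral>\<omega>. (norm (y i k t \<omega> - grad (q i) (xbar k \<omega>)))\<^sup>2 \<partial>M)
      + \<alpha> k * L\<^sup>2 * (\<integral>\<omega>. (norm (x i k t \<omega> - xbar k \<omega>))\<^sup>2 \<partial>M) + (\<alpha> k)\<^sup>2 * \<sigma>\<^sup>2"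
proof -
  define e where "e \<omega> = y i k t \<omega> - grad (q i) (xbar k \<omega>)" for \<omega>
  define d where "d \<omega> = grad (q i) (x i k t \<omega>) - grad (q i) (xbar k \<omega>)" for \<omega>
  \<comment> \<open>The new error is \<open>U\<close> plus \<open>\<alpha> k\<close> times the
    noise: \<open>e\<close> is the contracted old error and \<open>d\<close> the effect of local
    drift. Both are determined by the past, which makes the noise orthogonal to
    \<open>U\<close>.\<close>
  define U where "U \<omega> = (1 - \<alpha> k) *\<^sub>R e \<omega> + \<alpha> k *\<^sub>R d \<omega>" for \<omega>
  have t': "t \<le> T" using t by simp
  have e: "sq_integrable M e"
    unfolding e_def by (rule track_err_sq_integrable[OF i t'])
  have grad_t: "sq_integrable M (\<lambda>\<omega>. grad (q i) (x i k t \<omega>))"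
    by (rule sq_integrable_grad[OF x_sq_integrable[OF i t'] i])
  have d: "sq_integrable M d"
    unfolding d_def by (intro sq_integrable_diff grad_t sq_integrable_grad xbar_sq_integrable i)
  have U: "sq_integrable M U"
    unfolding U_def by (intro sq_integrable_add sq_integrable_scaleR e d)
  have dx: "sq_integrable M (\<lambda>\<omega>. x i k t \<omega> - xbar k \<omega>)"
    by (intro sq_integrable_diff x_sq_integrable i t' xbar_sq_integrable)
  have UP: "U \<in> borel_measurable (past k t)"
  proof -
    have [measurable]: "x i k t \<in> borel_measurable (past k t)" "y i k t \<in> borel_measurable (past k t)"
      "xbar k \<in> borel_measurable (past k t)"
      using x_past[OF t i] y_past[OF t i] xbar_past[OF t] by auto
    show ?thesis unfolding U_def e_def d_def using i by measurable
  qed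
  have "(\<integral>\<omega>. (norm (y i k (Suc t) \<omega> - grad (q i) (xbar k \<omega>)))\<^sup>2 \<partial>M)
      = (\<integral>\<omega>. (norm (U \<omega> + \<alpha> k *\<^sub>R (g i (x i k t \<omega>) (\<Delta> i k t \<omega>) - grad (q i) (x i k t \<omega>))))\<^sup>2 \<partial>M)"
    by (rule Bochner_Integration.integral_cong)
      (simp_all add: y_Suc i t U_def e_def d_def algebra_simps)
  also have "\<dots> \<le> (\<integral>\<omega>. (norm (U \<omega>))\<^sup>2 \<partial>M) + (\<alpha> k)\<^sup>2 * \<sigma>\<^sup>2"
    by (rule oracle_step_sq[OF past_subalgebra[OF t] noise[OF i t] x_past[OF t i]
          sample_gradient_measurable[OF i t] grad_t UP U])
  also have "(\<integral>\<omega>. (norm (U \<omega>))\<^sup>2 \<partial>M)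
      \<le> (\<integral>\<omega>. (1 - \<alpha> k) * (norm (e \<omega>))\<^sup>2 + \<alpha> k * L\<^sup>2 * (norm (x i k t \<omega> - xbar k \<omega>))\<^sup>2 \<partial>M)"
  proof (rule integral_mono)
    fix \<omega>
    have "(norm (U \<omega>))\<^sup>2 \<le> (1 - \<alpha> k) * (norm (e \<omega>))\<^sup>2 + \<alpha> k * (norm (d \<omega>))\<^sup>2"
      unfolding U_def using \<alpha>[of k] by (intro norm_convex_sq_le) auto
    also have "(norm (d \<omega>))\<^sup>2 \<le> (L * norm (x i k t \<omega> - xbar k \<omega>))\<^sup>2"
      unfolding d_def using smooth[OF i] by (intro power_mono) auto
    finally show "(norm (U \<omega>))\<^sup>2
        \<le> (1 - \<alpha> k) * (norm (e \<omega>))\<^sup>2 + \<alpha> k * L\<^sup>2 * (norm (x i k t \<omega> - xbar k \<omega>))\<^sup>2"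
      using \<alpha>(1)[of k] by (simp add: power_mult_distrib mult_left_mono mult.assoc)
  qed (use U e dx in \<open>simp_all add: sq_integrable_def\<close>)
  also have "\<dots> = (1 - \<alpha> k) * (\<integral>\<omega>. (norm (e \<omega>))\<^sup>2 \<partial>M)
      + \<alpha> k * L\<^sup>2 * (\<integral>\<omega>. (norm (x i k t \<omega> - xbar k \<omega>))\<^sup>2 \<partial>M)"
    using e dx by (simp add: sq_integrable_def)
  finally show ?thesis by (simp add: e_def)
qed

lemma track_step:
  assumes t: "t < T"
  shows "(\<integral>\<omega>. track k (Suc t) \<omega> \<partial>M)
    \<le> (1 - \<alpha> k) * (\<integral>\<omega>. track k t \<omega> \<partial>M) + (\<alpha> k * L\<^sup>2 * drift_bound k + (\<alpha> k)\<^sup>2 * \<sigma>\<^sup>2)"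
proof -
  have t': "t \<le> T" "Suc t \<le> T" using t by auto
  have "(\<integral>\<omega>. track k (Suc t) \<omega> \<partial>M)
      \<le> avg (\<lambda>i. (1 - \<alpha> k) * (\<integral>\<omega>. (norm (y i k t \<omega> - grad (q i) (xbar k \<omega>)))\<^sup>2 \<partial>M)
      + \<alpha> k * L\<^sup>2 * (\<integral>\<omega>. (norm (x i k t \<omega> - xbar k \<omega>))\<^sup>2 \<partial>M) + (\<alpha> k)\<^sup>2 * \<sigma>\<^sup>2)"
    unfolding integral_track[OF t'(2)] by (rule avg_mono) (rule agent_track_step[OF t])
  also have "\<dots> = (1 - \<alpha> k) * (\<integral>\<omega>. track k t \<omega> \<partial>M)
      + \<alpha> k * L\<^sup>2 * avg (\<lambda>i. \<integral>\<omega>. (norm (x i k t \<omega> - xbar k \<omega>))\<^sup>2 \<partial>M) + (\<alpha> k)\<^sup>2 * \<sigma>\<^sup>2"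
    unfolding integral_track[OF t'(1)] by (simp only: avg_add avg_mult avg_const)
  also have "\<dots> \<le> (1 - \<alpha> k) * (\<integral>\<omega>. track k t \<omega> \<partial>M) + \<alpha> k * L\<^sup>2 * drift_bound k + (\<alpha> k)\<^sup>2 * \<sigma>\<^sup>2"
    using mult_left_mono[OF drift_le[OF t'(1), of k], of "\<alpha> k * L\<^sup>2"] \<alpha>(1)[of k] by simp
  finally show ?thesis by simp
qed

lemma integral_gap_nonneg: "0 \<le> (\<integral>\<omega>. gap (xbar k \<omega>) \<partial>M)"
  by (simp add: gap_nonneg)

lemma integral_track_nonneg: "0 \<le> (\<integral>\<omega>. track k t \<omega> \<partial>M)"
  by (simp add: track_nonneg)

lemma integral_round_err_nonneg: "0 \<le> (\<integral>\<omega>. round_err k \<omega> \<partial>M)"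
  unfolding integral_round_err by (intro sum_nonneg integral_track_nonneg)

lemma drift_bound_nonneg: "0 \<le> drift_bound k"
  unfolding drift_bound_def using L integral_round_err_nonneg[of k] integral_gap_nonneg[of k] by simp

lemma
  shows integral_track_T_le: "(\<integral>\<omega>. track k T \<omega> \<partial>M) \<le> (1 - \<alpha> k) * (\<integral>\<omega>. track k 0 \<omega> \<partial>M)
      + real T * (\<alpha> k * L\<^sup>2 * drift_bound k + (\<alpha> k)\<^sup>2 * \<sigma>\<^sup>2)" (is ?A)
    and integral_round_err_le: "(\<integral>\<omega>. round_err k \<omega> \<partial>M) \<le> real T * (\<integral>\<omega>. track k 0 \<omega> \<partial>M)
      + (real T)\<^sup>2 * (\<alpha> k * L\<^sup>2 * drift_bound k + (\<alpha> k)\<^sup>2 * \<sigma>\<^sup>2)" (is ?B)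
proof -
  define c where "c = \<alpha> k * L\<^sup>2 * drift_bound k + (\<alpha> k)\<^sup>2 * \<sigma>\<^sup>2"
  have c: "0 \<le> c" using \<alpha>(1)[of k] drift_bound_nonneg[of k] by (simp add: c_def)
  have \<alpha>0: "0 \<le> \<alpha> k" using \<alpha>(1)[of k] by simp
  note iterate = contraction_iterate_le[where T = T and u = "\<lambda>t. \<integral>\<omega>. track k t \<omega> \<partial>M",
      OF track_step[where k = k, folded c_def] \<alpha>0 \<alpha>(2) c integral_track_nonneg]
  show ?A using iterate(2)[of T] T by (simp add: c_def)
  have "(\<integral>\<omega>. round_err k \<omega> \<partial>M) \<le> (\<Sum>t<T. (\<integral>\<omega>. track k 0 \<omega> \<partial>M) + real T * c)"
    unfolding integral_round_err
  proof (rule sum_mono)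
    fix t assume "t \<in> {..<T}"
    then have "real t * c \<le> real T * c" "t \<le> T" using c by (auto intro: mult_right_mono)
    with iterate(1)[of t] show "(\<integral>\<omega>. track k t \<omega> \<partial>M) \<le> (\<integral>\<omega>. track k 0 \<omega> \<partial>M) + real T * c"
      by linarith
  qed
  then show ?B by (simp add: c_def power2_eq_square algebra_simps)
qed

abbreviation V :: "nat \<Rightarrow> 'w \<Rightarrow> real" where "V \<equiv> V_fun H q xs xbar y"

text \<open>Kept as a random variable: the adversary may correlate it with the gap, so their product
  is integrated as a whole.\<close>

definition byz_frac :: "nat \<Rightarrow> 'w \<Rightarrow> real" where
  "byz_frac k \<omega> = real (card (F k \<omega> - H)) / real (card H)"

lemma byz_frac_measurable [measurable]: "byz_frac k \<in> borel_measurable M"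
  unfolding byz_frac_def by (rule measurable_compose[OF selection_measurable]) simp

lemma byz_frac_bounds:
  assumes "\<omega> \<in> space M"
  shows "0 \<le> byz_frac k \<omega>" "byz_frac k \<omega> \<le> 1"
  using card_mono[of "F k \<omega>" "F k \<omega> - H"] F_finite[OF assms, of k] card_F[OF assms, of k] card_pos
  by (simp_all add: byz_frac_def)

lemma integrable_byz_frac_mult:
  fixes \<phi> :: "'w \<Rightarrow> real"
  assumes "integrable M \<phi>"
  shows "integrable M (\<lambda>\<omega>. byz_frac k \<omega> * \<phi> \<omega>)"
proof (rule Bochner_Integration.integrable_bound[OF assms])
  show "(\<lambda>\<omega>. byz_frac k \<omega> * \<phi> \<omega>) \<in> borel_measurable M" using assms by simp
  show "AE \<omega> in M. norm (byz_frac k \<omega> * \<phi> \<omega>) \<le> norm (\<phi> \<omega>)"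
    using byz_frac_bounds by (intro AE_I2) (simp add: abs_mult mult_left_le_one_le)
qed

lemma V_eq: "V k \<omega> = gap (xbar k \<omega>) + track k 0 \<omega>"
  by (simp add: V_fun_def W_fun_def track_err_def gap_def track_def avg_def)

lemma V_nonneg: "0 \<le> V k \<omega>"
  by (simp add: V_eq gap_nonneg track_nonneg)

lemma V_integrable: "integrable M (V k)"
  unfolding V_eq by (intro Bochner_Integration.integrable_add gap_integrable track_integrable) simp

lemma integral_V: "(\<integral>\<omega>. V k \<omega> \<partial>M) = (\<integral>\<omega>. gap (xbar k \<omega>) \<partial>M) + (\<integral>\<omega>. track k 0 \<omega> \<partial>M)"
  unfolding V_eq by (intro Bochner_Integration.integral_add gap_integrable track_integrable) simp

text \<open>The weight \<open>\<alpha> k / 2\<close> spends half of the contraction, as \<open>(1 +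
  \<alpha> k / 2) * (1 - \<alpha> k) \<le> 1 - \<alpha> k / 2\<close>. Its price
  \<open>1 + 2 / \<alpha> k\<close> multiplies a drift of order \<open>\<beta> k ^ 2\<close>, which
  the small ratio can afford.\<close>

lemma integral_track_Suc_le:
  "(\<integral>\<omega>. track (Suc k) 0 \<omega> \<partial>M) \<le> (1 + \<alpha> k / 2) * (\<integral>\<omega>. track k T \<omega> \<partial>M)
    + (1 + 1 / (\<alpha> k / 2)) * L\<^sup>2 * drift_bound k"
proof -
  let ?d = "\<lambda>\<omega>. (\<beta> k)\<^sup>2 * real T * (2 * round_err k \<omega> + 4 * L * real T * gap (xbar k \<omega>))"
  have "(\<integral>\<omega>. track (Suc k) 0 \<omega> \<partial>M)
      \<le> (\<integral>\<omega>. (1 + \<alpha> k / 2) * track k T \<omega> + (1 + 1 / (\<alpha> k / 2)) * L\<^sup>2 * ?d \<omega> \<partial>M)"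
  proof (rule integral_mono)
    fix \<omega> assume \<omega>: "\<omega> \<in> space M"
    have "track (Suc k) 0 \<omega> \<le> avg (\<lambda>i. (norm (y i k T \<omega> - grad (q i) (xbar (Suc k) \<omega>)))\<^sup>2)"
      unfolding track_def by (rule avg_mono) (simp add: y_start[OF \<omega>])
    also have "\<dots> \<le> (1 + \<alpha> k / 2) * track k T \<omega> + (1 + 1 / (\<alpha> k / 2)) * L\<^sup>2 * ?d \<omega>"
      unfolding track_def round_err_def
      using aggregation_round.tracking_step[OF server_round[OF \<omega>, of k], of "\<alpha> k / 2" "\<lambda>i. y i k T \<omega>"]
        \<alpha>(1)[of k]
      by (simp only: aggregation_round.err_def[OF server_round[OF \<omega>]])
    finally show "track (Suc k) 0 \<omega> \<le> (1 + \<alpha> k / 2) * track k T \<omega> + (1 + 1 / (\<alpha> k / 2)) * L\<^sup>2 * ?d \<omega>" .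
  qed (use track_integrable[of T k] track_integrable[of 0 "Suc k"] round_err_integrable[of k]
      gap_integrable[of k] in simp_all)
  also have "\<dots> = (1 + \<alpha> k / 2) * (\<integral>\<omega>. track k T \<omega> \<partial>M) + (1 + 1 / (\<alpha> k / 2)) * L\<^sup>2 * drift_bound k"
    using track_integrable[of T k] round_err_integrable[of k] gap_integrable[of k]
    by (simp add: drift_bound_def)
  finally show ?thesis .
qed

lemma integral_gap_Suc_le:
  assumes mu: "0 < \<mu>"
    and PL: "AE \<omega> in M.
      1/2 * (norm (grad (avg_obj H q) (xbar k \<omega>)))\<^sup>2 \<ge> \<mu> * gap (xbar k \<omega>) \<and>
      \<mu> * gap (xbar k \<omega>) \<ge> \<mu>\<^sup>2 / 2 * (norm (xbar k \<omega> - xs))\<^sup>2"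
  shows "(\<integral>\<omega>. gap (xbar (Suc k) \<omega>) \<partial>M) \<le> (\<integral>\<omega>. gap (xbar k \<omega>) \<partial>M)
    - 2 * \<mu> * \<beta> k * real T * (\<integral>\<omega>. gap (xbar k \<omega>) \<partial>M)
    + 4 * L * real T * \<beta> k * (\<integral>\<omega>. byz_frac k \<omega> * gap (xbar k \<omega>) \<partial>M)
    + \<beta> k * (real T * (\<mu> / 4 * (\<integral>\<omega>. gap (xbar k \<omega>) \<partial>M)) + 18 * (L / \<mu>) * (\<integral>\<omega>. round_err k \<omega> \<partial>M))
    + L / 2 * drift_bound k"
proof -
  define c1 where "c1 = 1 - 2 * \<mu> * \<beta> k * real T + \<beta> k * real T * (\<mu> / 4)
    + L / 2 * (\<beta> k)\<^sup>2 * real T * (4 * L * real T)"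
  define c2 where "c2 = 4 * L * real T * \<beta> k"
  define c3 where "c3 = \<beta> k * (18 * (L / \<mu>)) + L / 2 * (\<beta> k)\<^sup>2 * real T * 2"
  have "(\<integral>\<omega>. gap (xbar (Suc k) \<omega>) \<partial>M)
      \<le> (\<integral>\<omega>. c1 * gap (xbar k \<omega>) + c2 * (byz_frac k \<omega> * gap (xbar k \<omega>)) + c3 * round_err k \<omega> \<partial>M)"
  proof (rule integral_mono_AE)
    show "AE \<omega> in M. gap (xbar (Suc k) \<omega>)
        \<le> c1 * gap (xbar k \<omega>) + c2 * (byz_frac k \<omega> * gap (xbar k \<omega>)) + c3 * round_err k \<omega>"
      using PL AE_space
    proof eventually_elim
      case (elim \<omega>)
      note r = server_round[OF elim(2), of k]
      have "gap (xbar (Suc k) \<omega>) \<le> gap (xbar k \<omega>)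
          + \<beta> k * real T * ((4 * L * byz_frac k \<omega> - 2 * \<mu>) * gap (xbar k \<omega>))
          + \<beta> k * (real T * (\<mu> / 4 * gap (xbar k \<omega>)) + 18 * (L / \<mu>) * round_err k \<omega>)
          + L / 2 * ((\<beta> k)\<^sup>2 * real T * (2 * round_err k \<omega> + 4 * L * real T * gap (xbar k \<omega>)))"
        using aggregation_round.gap_step[OF r mu conjunct1[OF elim(1)] conjunct2[OF elim(1)] T]
        unfolding aggregation_round.err_def[OF r] round_err_def byz_frac_def .
      then show ?case
        by (simp add: c1_def c2_def c3_def algebra_simps)
    qed
  qed (use gap_integrable[of k] gap_integrable[of "Suc k"] round_err_integrable[of k]
      integrable_byz_frac_mult[OF gap_integrable, of k k] in simp_all)
  also have "\<dots> = c1 * (\<integral>\<omega>. gap (xbar k \<omega>) \<partial>M)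
      + c2 * (\<integral>\<omega>. byz_frac k \<omega> * gap (xbar k \<omega>) \<partial>M) + c3 * (\<integral>\<omega>. round_err k \<omega> \<partial>M)"
    using gap_integrable[of k] round_err_integrable[of k]
      integrable_byz_frac_mult[OF gap_integrable, of k k] by simp
  finally show ?thesis
    by (simp add: c1_def c2_def c3_def drift_bound_def algebra_simps)
qed

lemma expected_V_step:
  assumes mu: "0 < \<mu>" "\<mu> \<le> L"
    and ratio: "\<beta> k / \<alpha> k \<le> \<mu>\<^sup>2 / (12^4 * (L + 1)^4 * (real T)\<^sup>2)"
    and PL: "AE \<omega> in M.
      1/2 * (norm (grad (avg_obj H q) (xbar k \<omega>)))\<^sup>2 \<ge> \<mu> * gap (xbar k \<omega>) \<and>
      \<mu> * gap (xbar k \<omega>) \<ge> \<mu>\<^sup>2 / 2 * (norm (xbar k \<omega> - xs))\<^sup>2"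
  shows "(\<integral>\<omega>. V (Suc k) \<omega> \<partial>M)
    \<le> (\<integral>\<omega>. (1 - 9 * \<mu> * real T * \<beta> k / 6
               + 4 * L * real T * \<beta> k * real (card (F k \<omega> - H)) / real (card H)) * V k \<omega> \<partial>M)
      + 150 * real T * \<sigma>\<^sup>2 * (\<alpha> k)\<^sup>2"
proof -
  define Q where "Q = (\<integral>\<omega>. gap (xbar k \<omega>) \<partial>M)"
  define a0 where "a0 = (\<integral>\<omega>. track k 0 \<omega> \<partial>M)"
  define R where "R = (\<integral>\<omega>. byz_frac k \<omega> * gap (xbar k \<omega>) \<partial>M)"
  define R' where "R' = (\<integral>\<omega>. byz_frac k \<omega> * V k \<omega> \<partial>M)"
  have rec: "Q - 2 * \<mu> * \<beta> k * real T * Q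
      + \<beta> k * (real T * (\<mu> / 4 * Q) + 18 * (L / \<mu>) * (\<integral>\<omega>. round_err k \<omega> \<partial>M)) + L / 2 * drift_bound k
      + ((1 + \<alpha> k / 2) * (\<integral>\<omega>. track k T \<omega> \<partial>M) + (1 + 1 / (\<alpha> k / 2)) * L\<^sup>2 * drift_bound k)
    \<le> (1 - 3 / 2 * \<mu> * real T * \<beta> k) * (Q + a0) + 150 * real T * \<sigma>\<^sup>2 * (\<alpha> k)\<^sup>2"
    unfolding Q_def drift_bound_def
  proof (rule round_recursion[OF mu _ \<alpha> \<beta> ratio])
    show "1 \<le> real T" using T by simp
    show "0 \<le> a0" by (simp add: a0_def integral_track_nonneg)
  qed (use integral_round_err_nonneg integral_gap_nonneg integral_track_T_le[of k]
      integral_round_err_le[of k] in \<open>simp_all add: drift_bound_def a0_def\<close>)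
  \<comment> \<open>The Byzantine term was obtained for the gap alone; adding the nonnegative
    tracking error turns it into a factor on \<open>V\<close>.\<close>
  have "R \<le> R'"
    unfolding R_def R'_def
  proof (rule integral_mono)
    fix \<omega> assume "\<omega> \<in> space M"
    then show "byz_frac k \<omega> * gap (xbar k \<omega>) \<le> byz_frac k \<omega> * V k \<omega>"
      using byz_frac_bounds track_nonneg by (intro mult_left_mono) (auto simp: V_eq)
  qed (intro integrable_byz_frac_mult gap_integrable V_integrable)+
  then have "4 * L * real T * \<beta> k * R \<le> 4 * L * real T * \<beta> k * R'"
    using L \<beta>[of k] by (intro mult_left_mono) auto
  then have "(\<integral>\<omega>. V (Suc k) \<omega> \<partial>M)
      \<le> (1 - 9 * \<mu> * real T * \<beta> k / 6) * (\<integral>\<omega>. V k \<omega> \<partial>M) + 4 * L * real T * \<beta> k * R'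
        + 150 * real T * \<sigma>\<^sup>2 * (\<alpha> k)\<^sup>2"
    using integral_gap_Suc_le[OF mu(1) PL] integral_track_Suc_le[of k] rec
    unfolding integral_V Q_def[symmetric] a0_def[symmetric] R_def[symmetric] by (simp add: mult_ac)
  also have "(1 - 9 * \<mu> * real T * \<beta> k / 6) * (\<integral>\<omega>. V k \<omega> \<partial>M) + 4 * L * real T * \<beta> k * R'
      = (\<integral>\<omega>. (1 - 9 * \<mu> * real T * \<beta> k / 6) * V k \<omega>
          + 4 * L * real T * \<beta> k * (byz_frac k \<omega> * V k \<omega>) \<partial>M)"
    unfolding R'_def
    using V_integrable[of k] integrable_byz_frac_mult[OF V_integrable, of k k] by simp
  also have "\<dots> = (\<integral>\<omega>. (1 - 9 * \<mu> * real T * \<beta> k / 6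
      + 4 * L * real T * \<beta> k * real (card (F k \<omega> - H)) / real (card H)) * V k \<omega> \<partial>M)"
    by (simp only: byz_frac_def distrib_right times_divide_eq_left times_divide_eq_right mult.assoc)
  finally show ?thesis by simp
qed

text \<open>No more than the \<open>N - (N - f)\<close> agents outside \<open>H\<close> can be
  foreign survivors. Truncated subtraction does no harm, since \<open>H\<close> is nonempty and
  therefore \<open>f < N\<close>.\<close>

lemma byz_frac_le:
  assumes "\<omega> \<in> space M"
  shows "byz_frac k \<omega> \<le> real f / (real N - real f)"
proof -
  have n: "real (card H) = real N - real f" using agents H by auto
  have "card (F k \<omega> - H) \<le> card ({..<N} - H)"
    using F_subset[OF assms, of k] by (intro card_mono) auto
  also have "\<dots> \<le> f" using agents H(1) by (simp add: card_Diff_subset)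
  finally show ?thesis using card_pos unfolding byz_frac_def n by (simp add: divide_right_mono)
qed

end

section \<open>From the one-round bound to the rate\<close>

lemma decreasing_step_recursion:
  fixes v :: "nat \<Rightarrow> real"
  assumes step: "\<And>k. v (Suc k) \<le> (1 - 2 / (1 + h + real k)) * v k + C / (1 + h + real k)\<^sup>2"
    and h: "0 < h" and C: "0 \<le> C" and v: "\<And>k. 0 \<le> v k"
  shows "v (Suc k) \<le> h\<^sup>2 * v 0 / (1 + h + real k)\<^sup>2 + C / (1 + h + real k)"
proof -
  have scaled: "(1 + h + real k)\<^sup>2 * v (Suc k) \<le> (h + real k)\<^sup>2 * v k + C" for k
  proof -
    let ?s = "1 + h + real k"
    have s: "?s > 0" using h by simp
    have "?s\<^sup>2 * v (Suc k) \<le> ?s\<^sup>2 * ((1 - 2 / ?s) * v k + C / ?s\<^sup>2)"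
      by (intro mult_left_mono step) simp
    also have "\<dots> = (?s\<^sup>2 * (1 - 2 / ?s)) * v k + C" using s by (simp add: algebra_simps)
    \<comment> \<open>Here \<open>s^2 - 2 * s = (s - 1)^2 - 1\<close>, and \<open>s - 1\<close> is
      the weight of the preceding round; the scaled values therefore grow by at most
      \<open>C\<close> per round. The leftover \<open>- v k\<close> is nonpositive.\<close>
    also have "?s\<^sup>2 * (1 - 2 / ?s) = (h + real k)\<^sup>2 - 1"
      using s by (simp add: power2_eq_square field_simps)
    finally show ?thesis using v[of k] by (simp add: algebra_simps)
  qed
  have "(1 + h + real k)\<^sup>2 * v (Suc k) \<le> h\<^sup>2 * v 0 + real (Suc k) * C"
  proof (induction k)
    case 0 then show ?case using scaled[of 0] by simp
  next
    case (Suc k)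
    then show ?case using scaled[of "Suc k"] by (simp add: algebra_simps)
  qed
  then have "v (Suc k) \<le> (h\<^sup>2 * v 0 + real (Suc k) * C) / (1 + h + real k)\<^sup>2"
    using h by (simp add: field_simps)
  \<comment> \<open>The \<open>k + 1\<close> accumulated copies of \<open>C\<close> are rounded up
    to \<open>1 + h + k\<close>, which cancels one power of the denominator.\<close>
  also have "\<dots> \<le> (h\<^sup>2 * v 0 + (1 + h + real k) * C) / (1 + h + real k)\<^sup>2"
    using h C by (intro divide_right_mono add_left_mono mult_right_mono) auto
  also have "\<dots> = h\<^sup>2 * v 0 / (1 + h + real k)\<^sup>2 + C / (1 + h + real k)"
    using h by (simp add: add_divide_distrib power2_eq_square)
  finally show ?thesis .
qed

text \<open>The bound \<open>\<mu> \<le> L\<close> excludes only the case that every iterate equals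
  \<open>xs\<close> almost surely: at any other point the gap lies between \<open>\<mu> / 2\<close>
  and \<open>L / 2\<close> times the squared distance to \<open>xs\<close>, by the PL condition and
  by smoothness.\<close>

theorem theorem2:
  fixes M :: "'w measure" and D :: "'s measure"
    and N f T :: nat and H :: "nat set"
    and q :: "nat \<Rightarrow> 'v::euclidean_space \<Rightarrow> real"
    and g :: "nat \<Rightarrow> 'v \<Rightarrow> 's \<Rightarrow> 'v"
    and \<Delta> :: "nat \<Rightarrow> nat \<Rightarrow> nat \<Rightarrow> 'w \<Rightarrow> 's"
    and x0 :: 'v and y0 :: "nat \<Rightarrow> 'v"
    and xbar :: "nat \<Rightarrow> 'w \<Rightarrow> 'v"
    and x y :: "nat \<Rightarrow> nat \<Rightarrow> nat \<Rightarrow> 'w \<Rightarrow> 'v"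
    and F :: "nat \<Rightarrow> 'w \<Rightarrow> nat set"
    and \<alpha> \<beta> :: "nat \<Rightarrow> real"
    and C\<alpha> C\<beta> h L \<sigma> \<mu> :: real
    and xs :: 'v
  assumes prob: "prob_space M"
    and agents: "H \<subseteq> {..<N}" "f < N" "card H = N - f"
    and T: "T \<ge> 1"
    and differentiable: "\<And>i z. i \<in> H \<Longrightarrow> q i differentiable (at z)"
    and redundancy: "redundancy N f H q"
    and common_minimizers: "(\<Inter>i\<in>H. minimizers (q i)) = minimizers (avg_obj H q)"
    and minimizer: "xs \<in> minimizers (avg_obj H q)"
    and L: "L > 0"
    and smooth: "\<And>i z w. i \<in> H \<Longrightarrow> norm (grad (q i) w - grad (q i) z) \<le> L * norm (w - z)"
    and oracle_measurable:
      "\<And>i. i \<in> H \<Longrightarrow> (\<lambda>(z, s). g i z s) \<in> borel_measurable (borel \<Otimes>\<^sub>M D)"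
    and samples_indep:
      "prob_space.indep_vars M (\<lambda>_. D) (\<lambda>(i, k, t). \<Delta> i k t) (H \<times> UNIV \<times> {..<T})"
    and samples_ident: "\<And>i k t i' k' t'. \<lbrakk>i \<in> H; t < T; i' \<in> H; t' < T\<rbrakk> \<Longrightarrow>
      distr M D (\<Delta> i k t) = distr M D (\<Delta> i' k' t')"
    and byzantine_measurable:
      "\<And>i k. i \<in> {..<N} - H \<Longrightarrow> x i k T \<in> borel_measurable M"
    and selection_measurable: "\<And>k. F k \<in> measurable M (count_space UNIV)"
    and algorithm: "\<And>\<omega>. \<omega> \<in> space M \<Longrightarrow>
      algorithm_path N f H T \<alpha> \<beta> g x0 y0 (\<lambda>i k t. \<Delta> i k t \<omega>)
        (\<lambda>k. xbar k \<omega>) (\<lambda>i k t. x i k t \<omega>) (\<lambda>i k t. y i k t \<omega>) (\<lambda>k. F k \<omega>)"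
    and noise: "\<And>i k t. \<lbrakk>i \<in> H; t < T\<rbrakk> \<Longrightarrow>
      gradient_oracle M (history M D N H T \<Delta> xbar x y F k t) (g i) (grad (q i)) (\<Delta> i k t) \<sigma>"
    and step_sizes: "\<And>k. \<alpha> k = C\<alpha> / (1 + h + real k)" "\<And>k. \<beta> k = C\<beta> / (1 + h + real k)"
      "h > 1" "0 < C\<beta>" "C\<beta> \<le> C\<alpha>" "\<And>k. \<alpha> k \<le> 1" "\<And>k. L * real T * \<beta> k \<le> 1"
    and mu: "\<mu> > 0" "\<mu> \<le> L"
    and PL: "\<And>k. AE \<omega> in M.
      1/2 * (norm (grad (avg_obj H q) (xbar k \<omega>)))\<^sup>2
        \<ge> \<mu> * (avg_obj H q (xbar k \<omega>) - avg_obj H q xs) \<and>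
      \<mu> * (avg_obj H q (xbar k \<omega>) - avg_obj H q xs)
        \<ge> \<mu>\<^sup>2 / 2 * (norm (xbar k \<omega> - xs))\<^sup>2"
    and small_steps:
      "\<And>k. \<alpha> k \<le> \<mu>\<^sup>2 / (6^4 * (L + 1)^3 * real T)"
      "\<And>k. \<beta> k \<le> \<mu>\<^sup>2 / (12^4 * L^3 * real T)"
      "\<And>k. \<beta> k / \<alpha> k \<le> \<mu>\<^sup>2 / (12^4 * (L + 1)^4 * (real T)\<^sup>2)"
  shows "(\<forall>k.
      (\<integral>\<omega>. V_fun H q xs xbar y (Suc k) \<omega> \<partial>M)
        \<le> (\<integral>\<omega>. (1 - 9 * \<mu> * real T * \<beta> k / 6
                   + 4 * L * real T * \<beta> k * real (card (F k \<omega> - H)) / real (card H))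
                * V_fun H q xs xbar y k \<omega> \<partial>M)
          + 150 * (L + 1)\<^sup>2 * (real T)\<^sup>2 * \<sigma>\<^sup>2 * (\<alpha> k)\<^sup>2
          + 112 * (L + 1)\<^sup>2 * (real T)\<^sup>2 * \<sigma>\<^sup>2 * real f * (\<alpha> k)\<^sup>2 / real (card H))
    \<and>
    (real f / (real N - real f) \<le> \<mu> / (3 * L)
      \<and> C\<alpha> \<ge> 12^5 * (L + 1)^4 * real T / \<mu>^3
      \<and> C\<beta> = 12 / (\<mu> * real T)
      \<and> h \<ge> max (6^4 * (L + 1)^3 * real T * C\<alpha> / \<mu>\<^sup>2) (12^5 * L^3 / \<mu>^3)
    \<longrightarrow> (\<forall>k.
      (\<integral>\<omega>. V_fun H q xs xbar y (Suc k) \<omega> \<partial>M)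
        \<le> h\<^sup>2 * (\<integral>\<omega>. V_fun H q xs xbar y 0 \<omega> \<partial>M) / (1 + h + real k)\<^sup>2
          + 150 * real T * \<sigma>\<^sup>2 * C\<alpha>\<^sup>2 / (1 + h + real k)
          + 112 * (real T)\<^sup>2 * \<sigma>\<^sup>2 * real f * C\<alpha>\<^sup>2 / ((1 + h + real k) * real (card H))))"
proof -
  interpret M: prob_space M by (rule prob)
  have H: "finite H" "H \<noteq> {}"
    using agents finite_subset by auto
  have hk: "0 < 1 + h + real k" for k using step_sizes(3) by simp
  have sgd: "byzantine_sgd H q L xs M D N f T g \<Delta> x0 y0 xbar x y F \<alpha> \<beta> \<sigma>"
  proof (intro byzantine_sgd.intro honest_objectives.intro byzantine_sgd_axioms.intro prob)
    \<comment> \<open>The intersection form of redundancy turns a minimizer of the average into a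
      minimizer of each honest objective.\<close>
    show "xs \<in> minimizers (q i)" if "i \<in> H" for i
      using common_minimizers minimizer that by blast
    show "\<Delta> i k t \<in> measurable M D" if "i \<in> H" "t < T" for i k t
      using samples_indep that unfolding M.indep_vars_def by force
    show "0 < \<alpha> k" "0 < \<beta> k" for k
      using step_sizes(1,2)[of k] step_sizes(4,5) hk[of k] by simp_all
  qed (fact | rule assms; assumption)+
  interpret sgd: byzantine_sgd H q L xs M D N f T g \<Delta> x0 y0 xbar x y F \<alpha> \<beta> \<sigma>
    by (rule sgd)
  let ?E = "\<lambda>k. \<integral>\<omega>. V_fun H q xs xbar y k \<omega> \<partial>M"
  let ?c = "\<lambda>k \<omega>. 1 - 9 * \<mu> * real T * \<beta> k / 6
    + 4 * L * real T * \<beta> k * real (card (F k \<omega> - H)) / real (card H)"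
  have step: "?E (Suc k) \<le> (\<integral>\<omega>. ?c k \<omega> * V_fun H q xs xbar y k \<omega> \<partial>M)
      + 150 * real T * \<sigma>\<^sup>2 * (\<alpha> k)\<^sup>2" for k
    by (rule sgd.expected_V_step[OF mu small_steps(3)]) (use PL in \<open>simp add: sgd.gap_def\<close>)
  have T_1: "1 \<le> real T" using T by simp
  show ?thesis
  proof (intro conjI allI impI)
    fix k
    \<comment> \<open>The sharper noise term is inflated to the stated one only for part
      (i).\<close>
    have "real T * 1 \<le> (real T)\<^sup>2 * (L + 1)\<^sup>2"
      using T_1 L by (intro mult_mono) (auto simp: power2_eq_square intro: mult_ge1_I)
    then have "150 * (\<sigma>\<^sup>2 * (\<alpha> k)\<^sup>2) * (real T * 1) \<le> 150 * (\<sigma>\<^sup>2 * (\<alpha> k)\<^sup>2) * ((real T)\<^sup>2 * (L + 1)\<^sup>2)"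
      by (intro mult_left_mono) auto
    then have "150 * real T * \<sigma>\<^sup>2 * (\<alpha> k)\<^sup>2 \<le> 150 * (L + 1)\<^sup>2 * (real T)\<^sup>2 * \<sigma>\<^sup>2 * (\<alpha> k)\<^sup>2"
      by (simp add: mult_ac)
    moreover have "0 \<le> 112 * (L + 1)\<^sup>2 * (real T)\<^sup>2 * \<sigma>\<^sup>2 * real f * (\<alpha> k)\<^sup>2 / real (card H)"
      by simp
    ultimately show "?E (Suc k) \<le> (\<integral>\<omega>. ?c k \<omega> * V_fun H q xs xbar y k \<omega> \<partial>M)
          + 150 * (L + 1)\<^sup>2 * (real T)\<^sup>2 * \<sigma>\<^sup>2 * (\<alpha> k)\<^sup>2
          + 112 * (L + 1)\<^sup>2 * (real T)\<^sup>2 * \<sigma>\<^sup>2 * real f * (\<alpha> k)\<^sup>2 / real (card H)"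
      using step[of k] by linarith
  next
    fix k
    assume *: "real f / (real N - real f) \<le> \<mu> / (3 * L)
      \<and> C\<alpha> \<ge> 12^5 * (L + 1)^4 * real T / \<mu>^3
      \<and> C\<beta> = 12 / (\<mu> * real T)
      \<and> h \<ge> max (6^4 * (L + 1)^3 * real T * C\<alpha> / \<mu>\<^sup>2) (12^5 * L^3 / \<mu>^3)"
    have contraction: "(\<integral>\<omega>. ?c k \<omega> * V_fun H q xs xbar y k \<omega> \<partial>M) \<le> (1 - 2 / (1 + h + real k)) * ?E k" for k
    proof -
      have "(\<integral>\<omega>. ?c k \<omega> * V_fun H q xs xbar y k \<omega> \<partial>M)
          \<le> (\<integral>\<omega>. (1 - 2 / (1 + h + real k)) * V_fun H q xs xbar y k \<omega> \<partial>M)"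
      proof (rule integral_mono)
        have "(\<lambda>\<omega>. ?c k \<omega> * V_fun H q xs xbar y k \<omega>)
            = (\<lambda>\<omega>. (1 - 9 * \<mu> * real T * \<beta> k / 6) * V_fun H q xs xbar y k \<omega>
              + 4 * L * real T * \<beta> k * (sgd.byz_frac k \<omega> * V_fun H q xs xbar y k \<omega>))"
          by (simp add: sgd.byz_frac_def distrib_right mult.assoc)
        then show "integrable M (\<lambda>\<omega>. ?c k \<omega> * V_fun H q xs xbar y k \<omega>)"
          using sgd.V_integrable[of k] sgd.integrable_byz_frac_mult[OF sgd.V_integrable, of k k] by simp
        show "integrable M (\<lambda>\<omega>. (1 - 2 / (1 + h + real k)) * V_fun H q xs xbar y k \<omega>)"
          using sgd.V_integrable[of k] by simp
        fix \<omega> assume "\<omega> \<in> space M"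
        then have "sgd.byz_frac k \<omega> \<le> \<mu> / (3 * L)"
          using sgd.byz_frac_le[of \<omega> k] * by linarith
        then have "4 * L * real T * \<beta> k * sgd.byz_frac k \<omega> \<le> 4 * L * real T * \<beta> k * (\<mu> / (3 * L))"
          using L sgd.\<beta>[of k] by (intro mult_left_mono) auto
        \<comment> \<open>Of the rate 9/6 the Byzantine agents consume at most 4/3 = 8/6. The
          remaining 1/6 becomes \<open>2 / (1 + h + k)\<close> through
          \<open>C\<beta> = 12 / (\<mu> * T)\<close>; the numerator 2 is what the squared weights of
          \<open>decreasing_step_recursion\<close> call for.\<close>
        also have "\<dots> = 8 / 6 * (\<mu> * real T * \<beta> k)" using L by simp
        finally have "?c k \<omega> \<le> 1 - \<mu> * real T * \<beta> k / 6" by (simp add: sgd.byz_frac_def)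
        also have "\<mu> * real T * \<beta> k / 6 = 2 / (1 + h + real k)"
          using * mu T_1 hk[of k] by (simp add: step_sizes(2) field_simps)
        finally show "?c k \<omega> * V_fun H q xs xbar y k \<omega>
            \<le> (1 - 2 / (1 + h + real k)) * V_fun H q xs xbar y k \<omega>"
          using sgd.V_nonneg by (rule mult_right_mono)
      qed
      then show ?thesis by simp
    qed
    define C where "C = 150 * real T * \<sigma>\<^sup>2 * C\<alpha>\<^sup>2"
    have "?E (Suc k) \<le> h\<^sup>2 * ?E 0 / (1 + h + real k)\<^sup>2 + C / (1 + h + real k)"
    proof (rule decreasing_step_recursion)
      show "?E (Suc k) \<le> (1 - 2 / (1 + h + real k)) * ?E k + C / (1 + h + real k)\<^sup>2" for k
        using step[of k] contraction[of k] unfolding C_def step_sizes(1) by (simp add: power_divide)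
      show "0 \<le> ?E k" for k by (simp add: sgd.V_nonneg)
    qed (use step_sizes(3) in \<open>simp_all add: C_def\<close>)
    moreover have "0 \<le> 112 * (real T)\<^sup>2 * \<sigma>\<^sup>2 * real f * C\<alpha>\<^sup>2 / ((1 + h + real k) * real (card H))"
      using hk[of k] by simp
    ultimately show "?E (Suc k) \<le> h\<^sup>2 * ?E 0 / (1 + h + real k)\<^sup>2
          + 150 * real T * \<sigma>\<^sup>2 * C\<alpha>\<^sup>2 / (1 + h + real k)
          + 112 * (real T)\<^sup>2 * \<sigma>\<^sup>2 * real f * C\<alpha>\<^sup>2 / ((1 + h + real k) * real (card H))"
      unfolding C_def by linarith
  qed
qed

end
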